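(* Let $\mathcal{S}=\{(-1,1),(1,1),(1,-1)\}$. Neither the complete generating function $Q_{\mathcal{S}}(x,y;t)$ (as a function of $x,y,t$) nor the counting generating function $W_{\mathcal{S}}(t)=Q_{\mathcal{S}}(1,1;t)$ (as a function of $t$) of walks in the first quadrant with steps from $\mathcal{S}$ is holonomic.
   Context: A walk in the quarter plane with step set $\mathcal{S}$ is a finite sequence of lattice points $(0,0)=p_0,p_1,\dots,p_n$, all lying in $\mathbb{N}^2=\{(i,j): i,j\in\mathbb{Z}_{\ge 0}\}$, with $p_k-p_{k-1}\in\mathcal{S}$ for all $k$; $n$ is its length. $Q_{\mathcal{S}}(x,y;t)=\sum_{n,i,j} q_{n,i,j}x^iy^jt^n$, where $q_{n,i,j}$ is the number of such walks of length $n$ ending at $(i,j)$. A function/power series $G(x_1,\dots,x_m)$ is holonomic (D-finite) if the vector space over the field of rational functions in $x_1,\dots,x_m$ spanned by all partial derivatives of $G$ (of all orders) is finite dimensional. *)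

theory Defs
  imports
    Complex_Main
    "HOL-Computational_Algebra.Computational_Algebra"
    "HOL-Library.Product_Plus"
begin

unbundle fps_syntax

definition quarter_walks :: "(int \<times> int) set \<Rightarrow> nat \<Rightarrow> (int \<times> int) list set" where
  "quarter_walks S n = {p. length p = Suc n \<and> p ! 0 = (0, 0)
     \<and> (\<forall>k\<le>n. 0 \<le> fst (p ! k) \<and> 0 \<le> snd (p ! k))
     \<and> (\<forall>k<n. p ! Suc k - p ! k \<in> S)}"

definition quarter_count :: "(int \<times> int) set \<Rightarrow> nat \<Rightarrow> nat \<Rightarrow> nat \<Rightarrow> nat" where
  "quarter_count S n i j = card {p \<in> quarter_walks S n. p ! n = (int i, int j)}"

text \<open>
  Power series in $x, y, t$ are elements of \<^typ>\<open>complex fps fps fps\<close>: the outermost level is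
  the series in $t$, the middle one in $x$, the innermost one in $y$, so that
  \<^term>\<open>F $ n $ i $ j\<close> is the coefficient of $x^i y^j t^n$. Polynomials in $x, y, t$ are elements
  of \<^typ>\<open>complex poly poly poly\<close> with the same nesting.
\<close>

definition quarter_gf :: "(int \<times> int) set \<Rightarrow> complex fps fps fps" where
  "quarter_gf S = Abs_fps (\<lambda>n. Abs_fps (\<lambda>i. Abs_fps (\<lambda>j. of_nat (quarter_count S n i j))))"

text \<open>
  Evaluation at $x = y = 1$. It is meaningful for series whose coefficients with respect to $t$
  are polynomials in $x, y$, i.e. when the sets summed over are finite; see
  \<open>finite_quarter_gf_support\<close> below.
\<close>

definition eval_xy_1 :: "complex fps fps fps \<Rightarrow> complex fps" where
  "eval_xy_1 F = Abs_fps (\<lambda>n. \<Sum>(i, j) \<in> {(i, j). F $ n $ i $ j \<noteq> 0}. F $ n $ i $ j)"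

definition quarter_counting_gf :: "(int \<times> int) set \<Rightarrow> complex fps" where
  "quarter_counting_gf S = eval_xy_1 (quarter_gf S)"

lemma finite_quarter_walks:
  assumes "finite S"
  shows "finite (quarter_walks S n)"
proof (induction n)
  case 0
  have "quarter_walks S 0 \<subseteq> {[(0, 0)]}"
    by (auto simp: quarter_walks_def length_Suc_conv)
  then show ?case by (rule finite_subset) simp
next
  case (Suc n)
  have "quarter_walks S (Suc n) \<subseteq> (\<lambda>(p, s). p @ [p ! n + s]) ` (quarter_walks S n \<times> S)"
  proof
    fix p assume p: "p \<in> quarter_walks S (Suc n)"
    then have len: "length p = Suc (Suc n)" by (simp add: quarter_walks_def)
    let ?q = "take (Suc n) p" and ?s = "p ! Suc n - p ! n"
    have "?q \<in> quarter_walks S n" "?s \<in> S"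
      using p by (auto simp: quarter_walks_def)
    moreover have "p = ?q @ [?q ! n + ?s]"
      using len take_Suc_conv_app_nth[of "Suc n" p] by simp
    ultimately show "p \<in> (\<lambda>(p, s). p @ [p ! n + s]) ` (quarter_walks S n \<times> S)"
      by (intro image_eqI[where x = "(?q, ?s)"]) auto
  qed
  then show ?case
    by (rule finite_subset) (use Suc assms in auto)
qed

lemma finite_quarter_gf_support:
  assumes "finite S"
  shows "finite {(i, j). quarter_gf S $ n $ i $ j \<noteq> 0}"
proof -
  have "{(i, j). quarter_gf S $ n $ i $ j \<noteq> 0}
      \<subseteq> (\<lambda>p. (nat (fst (p ! n)), nat (snd (p ! n)))) ` quarter_walks S n"
  proof clarify
    fix i j assume "quarter_gf S $ n $ i $ j \<noteq> 0"
    then have "{p \<in> quarter_walks S n. p ! n = (int i, int j)} \<noteq> {}"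
      unfolding quarter_gf_def quarter_count_def by (auto simp del: Collect_empty_eq)
    then obtain p where "p \<in> quarter_walks S n" "p ! n = (int i, int j)" by blast
    then show "(i, j) \<in> (\<lambda>p. (nat (fst (p ! n)), nat (snd (p ! n)))) ` quarter_walks S n"
      by (intro image_eqI[where x = p]) auto
  qed
  then show ?thesis by (rule finite_subset) (simp add: finite_quarter_walks assms)
qed

lemma quarter_counting_gf_nth:
  assumes "finite S"
  shows "quarter_counting_gf S $ n = of_nat (card (quarter_walks S n))"
proof -
  let ?I = "{(i, j). quarter_gf S $ n $ i $ j \<noteq> 0}"
  let ?A = "\<lambda>(i, j). {p \<in> quarter_walks S n. p ! n = (int i, int j)}"
  have "quarter_walks S n = (\<Union>ij\<in>?I. ?A ij)"
  proof (intro equalityI subsetI)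
    fix p assume p: "p \<in> quarter_walks S n"
    define i j where "i = nat (fst (p ! n))" and "j = nat (snd (p ! n))"
    have ij: "p ! n = (int i, int j)"
      using p by (auto simp: i_def j_def quarter_walks_def prod_eq_iff)
    with p have "p \<in> ?A (i, j)" by simp
    moreover have "(i, j) \<in> ?I"
      using p ij finite_quarter_walks[OF assms, of n]
      by (auto simp: quarter_gf_def quarter_count_def)
    ultimately show "p \<in> (\<Union>ij\<in>?I. ?A ij)" by blast
  qed auto
  then have "card (quarter_walks S n) = card (\<Union>ij\<in>?I. ?A ij)" by simp
  also have "\<dots> = (\<Sum>ij\<in>?I. card (?A ij))"
    by (rule card_UN_disjoint)
       (use finite_quarter_gf_support[OF assms] finite_quarter_walks[OF assms] in \<open>auto\<close>)
  finally have "of_nat (card (quarter_walks S n)) = (\<Sum>ij\<in>?I. of_nat (card (?A ij)) :: complex)"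
    by simp
  also have "\<dots> = (\<Sum>(i, j)\<in>?I. quarter_gf S $ n $ i $ j)"
    by (rule sum.cong) (auto simp: quarter_gf_def quarter_count_def)
  finally show ?thesis by (simp add: quarter_counting_gf_def eval_xy_1_def)
qed


text \<open>
  Let \<open>\<iota>\<close> be the inclusion of a polynomial ring into a ring of formal power series. The field of
  rational functions is the fraction field of the former; it acts, through the induced
  inclusion of fields, on the fraction field of the latter, which serves as the vector space in
  which the span of the partial derivatives is formed.
\<close>

definition fract_map :: "('r::idom \<Rightarrow> 'p::idom) \<Rightarrow> 'r fract \<Rightarrow> 'p fract" where
  "fract_map \<iota> r = (THE z. \<exists>p q. q \<noteq> 0 \<and> r = Fract p q \<and> z = Fract (\<iota> p) (\<iota> q))"

definition ratfun_scale :: "('r::idom \<Rightarrow> 'p::idom) \<Rightarrow> 'r fract \<Rightarrow> 'p fract \<Rightarrow> 'p fract" where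
  "ratfun_scale \<iota> r v = fract_map \<iota> r * v"

inductive_set iterated_derivs :: "('p \<Rightarrow> 'p) set \<Rightarrow> 'p \<Rightarrow> 'p set"
  for \<Delta> :: "('p \<Rightarrow> 'p) set" and G :: 'p where
  base: "G \<in> iterated_derivs \<Delta> G"
| step: "F \<in> iterated_derivs \<Delta> G \<Longrightarrow> D \<in> \<Delta> \<Longrightarrow> D F \<in> iterated_derivs \<Delta> G"

definition holonomic_wrt :: "('r::idom \<Rightarrow> 'p::idom) \<Rightarrow> ('p \<Rightarrow> 'p) set \<Rightarrow> 'p \<Rightarrow> bool" where
  "holonomic_wrt \<iota> \<Delta> G \<longleftrightarrow>
     (\<exists>B. finite B \<and>
        module.span (ratfun_scale \<iota>) ((\<lambda>F. Fract F 1) ` iterated_derivs \<Delta> G)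
          = module.span (ratfun_scale \<iota>) B)"

definition holonomic_t :: "complex fps \<Rightarrow> bool" where
  "holonomic_t = holonomic_wrt (fps_of_poly :: complex poly \<Rightarrow> complex fps) {fps_deriv}"

definition fps_of_poly_xyt :: "complex poly poly poly \<Rightarrow> complex fps fps fps" where
  "fps_of_poly_xyt p = Abs_fps (\<lambda>n. Abs_fps (\<lambda>i. Abs_fps (\<lambda>j. coeff (coeff (coeff p n) i) j)))"

definition deriv_t :: "complex fps fps fps \<Rightarrow> complex fps fps fps" where
  "deriv_t F = fps_deriv F"

definition deriv_x :: "complex fps fps fps \<Rightarrow> complex fps fps fps" where
  "deriv_x F = Abs_fps (\<lambda>n. fps_deriv (F $ n))"

definition deriv_y :: "complex fps fps fps \<Rightarrow> complex fps fps fps" where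
  "deriv_y F = Abs_fps (\<lambda>n. Abs_fps (\<lambda>i. fps_deriv (F $ n $ i)))"

definition holonomic_xyt :: "complex fps fps fps \<Rightarrow> bool" where
  "holonomic_xyt = holonomic_wrt fps_of_poly_xyt {deriv_x, deriv_y, deriv_t}"

lemma fract_map_Fract:
  assumes mult: "\<And>a b. \<iota> (a * b) = \<iota> a * \<iota> b"
    and inj: "inj \<iota>" and zero: "\<iota> 0 = 0" and "q \<noteq> 0"
  shows "fract_map \<iota> (Fract p q) = Fract (\<iota> p) (\<iota> q)"
  unfolding fract_map_def
proof (rule the_equality)
  show "\<exists>p' q'. q' \<noteq> 0 \<and> Fract p q = Fract p' q' \<and> Fract (\<iota> p) (\<iota> q) = Fract (\<iota> p') (\<iota> q')"
    using \<open>q \<noteq> 0\<close> by blast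
next
  have nz: "\<iota> a \<noteq> 0" if "a \<noteq> 0" for a
    using inj zero that by (metis injD)
  fix z assume "\<exists>p' q'. q' \<noteq> 0 \<and> Fract p q = Fract p' q' \<and> z = Fract (\<iota> p') (\<iota> q')"
  then obtain p' q' where *: "q' \<noteq> 0" "Fract p q = Fract p' q'" "z = Fract (\<iota> p') (\<iota> q')"
    by blast
  then have "p * q' = p' * q" using \<open>q \<noteq> 0\<close> by (simp add: eq_fract)
  then have "\<iota> p * \<iota> q' = \<iota> p' * \<iota> q" by (metis mult)
  with * show "z = Fract (\<iota> p) (\<iota> q)"
    using nz \<open>q \<noteq> 0\<close> by (simp add: eq_fract)
qed

lemma vector_space_ratfun_scale:
  assumes add: "\<And>a b. \<iota> (a + b) = \<iota> a + \<iota> b"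
    and mult: "\<And>a b. \<iota> (a * b) = \<iota> a * \<iota> b"
    and one: "\<iota> 1 = 1" and inj: "inj \<iota>"
  shows "vector_space (ratfun_scale \<iota>)"
proof -
  have zero: "\<iota> 0 = 0" using add[of 0 0] by (metis add_0 add_cancel_right_right)
  have nz: "\<iota> a \<noteq> 0" if "a \<noteq> 0" for a
    using inj zero that by (metis injD)
  note [simp] = fract_map_Fract[of \<iota>, OF mult inj zero]
  have fadd: "fract_map \<iota> (r + s) = fract_map \<iota> r + fract_map \<iota> s" for r s
    by (cases r, cases s) (simp add: nz add mult)
  have fmult: "fract_map \<iota> (r * s) = fract_map \<iota> r * fract_map \<iota> s" for r s
    by (cases r, cases s) (simp add: nz mult)
  have fone: "fract_map \<iota> 1 = 1"
    by (simp add: One_fract_def one)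
  show ?thesis
    by unfold_locales
       (simp_all add: ratfun_scale_def fadd fmult fone distrib_left distrib_right mult.assoc)
qed

lemma vector_space_ratfun_scale_t:
  "vector_space (ratfun_scale (fps_of_poly :: complex poly \<Rightarrow> complex fps))"
  by (rule vector_space_ratfun_scale)
     (auto simp: fps_of_poly_add fps_of_poly_mult inj_def)

lemma vector_space_ratfun_scale_xyt: "vector_space (ratfun_scale fps_of_poly_xyt)"
proof (rule vector_space_ratfun_scale)
  show "inj fps_of_poly_xyt"
    by (auto simp: inj_def fps_of_poly_xyt_def fps_eq_iff poly_eq_iff)
  show "fps_of_poly_xyt 1 = 1"
    by (auto simp: fps_of_poly_xyt_def fps_eq_iff coeff_1)
  show "fps_of_poly_xyt (a + b) = fps_of_poly_xyt a + fps_of_poly_xyt b" for a b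
    by (simp add: fps_of_poly_xyt_def fps_eq_iff)
  show "fps_of_poly_xyt (a * b) = fps_of_poly_xyt a * fps_of_poly_xyt b" for a b
    by (simp add: fps_of_poly_xyt_def fps_eq_iff fps_mult_nth coeff_mult fps_sum_nth coeff_sum
        atMost_atLeast0)
qed

unbundle no fps_syntax

end

theory Submission
  imports Defs "HOL-Complex_Analysis.Complex_Analysis"
begin

text \<open>
  Let $R(x) = Q(x, 0; t)$. Whenever $xy = t(x^2 y^2 + x^2 + y^2)$, the functional equation of the
  generating function gives $t x^2 R(x) + t y^2 R(y) = xy$. Iterating it along the solutions
  $x_0 = 1, x_1, x_2, \dots$ of the kernel that tend to $0$ yields
  $t R(1) = \sum_n (-1)^n x_n x_{n+1}$, while $(1 - 3t) W(t) = 1 - 2 t R(1)$. The iterates are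
  $x_n = (1 + c) q^n / (1 + c q^{2n})$ with $t = q / (1 + q^2)$ and
  $(1 + c)^2 q^2 = c (1 - q^2)^2$. With $z = s^2$ this curve is parametrised by
  $p = q^2 = z (1 - z) / (1 + z)$ and $c = (1 - z) / (z (1 + z))$, and the sum becomes a Lambert series
  in $p$ with terms $v p^k / (1 + v p^k)$, $v = c p$. This series converges wherever $|p| < 1$, so $W$
  continues meromorphically in $s$ from the neighbourhood of $s = 1$, where $t$ is small, through
  $s = 0$ up the imaginary axis, where it has infinitely many poles. The solutions of a linear
  differential equation with polynomial coefficients have poles only over the finitely many zeros
  of the leading coefficient, so $W$ is not holonomic. A differential equation in $t$ for
  $Q(x, y; t)$ would, after removal of common factors $x - 1$ and $y - 1$, specialise to one for $W$.
\<close>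

section \<open>Holonomic series satisfy differential equations\<close>

unbundle fps_syntax

text \<open>For fixed t the kernel curve has a node at the origin, hence is rational; its branches
  there have slopes q and 1/q with t = q / (1 + q^2), which is why the iterates decay like q^n. With
  v = c p the relation between c and q reads (p + v)^2 = v (1 - p)^2, so v is a square w^2 and p = w
  (1 - w) / (1 + w); the involution w = (1 - z) / (1 + z) turns this into p = z w. Passing to s
  leaves one square root in t, that of 1 - s^4, which has no branch point in the unit disc. The path
  from s = 1 to s = 0 passes z = sqrt 2 - 1, where dt/ds vanishes. Near s = 0 the parameter t is
  small again, but the continued function is no longer the series W. The differential equation is
  therefore carried along s, with d/dt read as (1/t') d/ds, on a domain from which finitely many
  points are deleted. For 0 < s < 1 both p and v are positive and no term has a pole; on the
  imaginary axis p < 0 and v > 1, so odd k give poles. As 0 < |p| < 1 at such a point, only one term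
  is singular there and the pole cannot cancel.\<close>

lemma holonomic_wrt_imp_relation:
  fixes \<iota> :: "'r::idom \<Rightarrow> 'p::idom"
  assumes vs: "vector_space (ratfun_scale \<iota>)"
    and mult: "\<And>a b. \<iota> (a * b) = \<iota> a * \<iota> b"
    and inj: "inj \<iota>" and zero: "\<iota> 0 = 0" and one: "\<iota> 1 = 1"
    and hol: "holonomic_wrt \<iota> \<Delta> G" and D: "D \<in> \<Delta>"
  shows "\<exists>N a. (\<exists>k\<le>N. a k \<noteq> 0) \<and> (\<Sum>k\<le>N. \<iota> (a k) * (D ^^ k) G) = 0"
proof -
  interpret vector_space "ratfun_scale \<iota>" by (rule vs)
  obtain B where B: "finite B"
    "span ((\<lambda>F. Fract F 1) ` iterated_derivs \<Delta> G) = span B"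
    using hol unfolding holonomic_wrt_def by blast
  have it: "(D ^^ k) G \<in> iterated_derivs \<Delta> G" for k
    by (induction k) (auto intro: iterated_derivs.intros D)
  define f where "f k = Fract ((D ^^ k) G) 1" for k
  have fB: "f k \<in> span B" for k
    unfolding B(2)[symmetric] f_def by (rule span_base) (use it in blast)
  \<comment> \<open>The indices 0..N number one more than the elements of \<open>B\<close>, which
    forces a dependence.\<close>
  define N where "N = card B"
  have "\<exists>c. (\<exists>k\<le>N. c k \<noteq> 0) \<and> (\<Sum>k\<le>N. ratfun_scale \<iota> (c k) (f k)) = 0"
  \<comment> \<open>Linear dependence is a property of a set of vectors, so a repeated derivative is
    treated apart; it is a relation by itself.\<close>
  proof (cases "inj_on f {..N}")
    case True
    have "\<not> independent (f ` {..N})"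
    proof
      assume "independent (f ` {..N})"
      then have "card (f ` {..N}) \<le> card B"
        using independent_span_bound[OF B(1)] fB by blast
      then show False using True by (simp add: card_image N_def)
    qed
    then obtain u where u: "(\<Sum>v\<in>f ` {..N}. ratfun_scale \<iota> (u v) v) = 0" "\<exists>v\<in>f ` {..N}. u v \<noteq> 0"
      using dependent_finite[of "f ` {..N}"] by auto
    then have "(\<Sum>k\<le>N. ratfun_scale \<iota> (u (f k)) (f k)) = 0"
      by (simp add: sum.reindex[OF True])
    then show ?thesis using u(2) by (intro exI[of _ "\<lambda>k. u (f k)"]) auto
  next
    case False
    then obtain i j where ij: "i \<le> N" "j \<le> N" "i \<noteq> j" "f i = f j"
      unfolding inj_on_def by auto
    define c where "c k = (if k = i then 1 else if k = j then - 1 else (0 :: 'r fract))" for k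
    have "(\<Sum>k\<le>N. ratfun_scale \<iota> (c k) (f k)) = (\<Sum>k\<in>{i,j}. ratfun_scale \<iota> (c k) (f k))"
      by (rule sum.mono_neutral_right) (use ij in \<open>auto simp: c_def\<close>)
    also have "\<dots> = 0" using ij by (simp add: c_def)
    finally show ?thesis using ij by (intro exI[of _ c]) (auto simp: c_def)
  qed
  then obtain c where c: "\<exists>k\<le>N. c k \<noteq> 0" "(\<Sum>k\<le>N. ratfun_scale \<iota> (c k) (f k)) = 0" by blast
  have "\<exists>d e. c k = Fract d e \<and> e \<noteq> 0" for k by (cases "c k") auto
  then obtain n d where nd: "\<And>k. c k = Fract (n k) (d k)" "\<And>k. d k \<noteq> 0" by metis
  have nz: "\<iota> a \<noteq> 0" if "a \<noteq> 0" for a using inj zero that by (metis injD)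
  \<comment> \<open>Clearing denominators: \<open>a k\<close> is \<open>c k\<close> times the
    product of all the \<open>d i\<close>.\<close>
  define a where "a k = n k * (\<Prod>i\<in>{..N}-{k}. d i)" for k
  define E where "E = Fract (\<Prod>i\<le>N. \<iota> (d i)) 1"
  have prod\<iota>: "\<iota> (\<Prod>i\<in>A. d i) = (\<Prod>i\<in>A. \<iota> (d i))" for A
    by (induction A rule: infinite_finite_induct) (auto simp: one mult)
  have *: "E * ratfun_scale \<iota> (c k) (f k) = Fract (\<iota> (a k) * (D ^^ k) G) 1" if "k \<le> N" for k
  proof -
    have "(\<Prod>i\<le>N. \<iota> (d i)) = \<iota> (d k) * (\<Prod>i\<in>{..N}-{k}. \<iota> (d i))"
      using that by (intro prod.remove) auto
    then show ?thesis
      by (simp add: E_def ratfun_scale_def nd fract_map_Fract[OF mult inj zero] f_def nz a_def mult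
          eq_fract prod\<iota>)
  qed
  have "Fract (\<Sum>k\<le>N. \<iota> (a k) * (D ^^ k) G) 1 = (\<Sum>k\<le>N. Fract (\<iota> (a k) * (D ^^ k) G) 1)"
  proof -
    have add: "Fract (x + y) 1 = Fract x 1 + Fract y (1::'p)" for x y by simp
    have "Fract (\<Sum>k\<in>A. g k) 1 = (\<Sum>k\<in>A. Fract (g k) (1::'p))" for A :: "nat set" and g
      by (induction A rule: infinite_finite_induct) (auto simp: Zero_fract_def add simp del: add_fract)
    then show ?thesis .
  qed
  also have "\<dots> = (\<Sum>k\<le>N. E * ratfun_scale \<iota> (c k) (f k))"
    by (rule sum.cong) (auto simp: *)
  also have "\<dots> = 0" by (simp add: c(2) flip: sum_distrib_left)
  finally have "(\<Sum>k\<le>N. \<iota> (a k) * (D ^^ k) G) = 0"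
    by (simp add: Zero_fract_def eq_fract)
  moreover have "\<exists>k\<le>N. a k \<noteq> 0"
    using c(1) nd by (auto simp: a_def Zero_fract_def eq_fract)
  ultimately show ?thesis by blast
qed

section \<open>Specialising linear relations over a polynomial ring at a point\<close>

text \<open>Plain evaluation at \<open>c\<close> could kill every \<open>a i\<close>. Dividing by X
  - c to the lowest multiplicity that occurs among the nonzero \<open>a i\<close> leaves a member
  that survives.\<close>

lemma factor_out_common_root:
  fixes a :: "'i \<Rightarrow> 'a::idom poly"
  assumes "finite I" "\<exists>i\<in>I. a i \<noteq> 0"
  shows "\<exists>m b. (\<forall>i\<in>I. a i = [:- c, 1:] ^ m * b i) \<and> (\<exists>i\<in>I. poly (b i) c \<noteq> 0)"
proof -
  define J where "J = {i \<in> I. a i \<noteq> 0}"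
  have J: "finite J" "J \<noteq> {}" using assms by (auto simp: J_def)
  define m where "m = Min ((\<lambda>i. order c (a i)) ` J)"
  have "\<exists>b. a i = [:- c, 1:] ^ m * b" if "i \<in> I" for i
  proof (cases "a i = 0")
    case False
    then have "m \<le> order c (a i)" using that J by (auto simp: m_def J_def)
    then have "[:- c, 1:] ^ m dvd a i" using le_imp_power_dvd order_1 dvd_trans by metis
    then show ?thesis by (auto simp: dvd_def)
  qed (auto intro: exI[of _ 0])
  then obtain b where b: "\<And>i. i \<in> I \<Longrightarrow> a i = [:- c, 1:] ^ m * b i" by metis
  have "m \<in> (\<lambda>i. order c (a i)) ` J" unfolding m_def by (rule Min_in) (use J in auto)
  then obtain i where i: "i \<in> I" "a i \<noteq> 0" "m = order c (a i)" by (auto simp: J_def)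
  have "poly (b i) c \<noteq> 0"
  proof
    assume "poly (b i) c = 0"
    then obtain d where "b i = [:- c, 1:] * d" by (metis dvdE poly_eq_0_iff_dvd)
    then have "a i = [:- c, 1:] ^ Suc m * d" using b[OF i(1)]
      by (simp only: power_Suc2 mult.assoc)
    then show False using order_2[OF i(2), of c] i(3) by (metis dvdI)
  qed
  then show ?thesis using b i(1) by blast
qed

text \<open>The common power of X - c cancels because the polynomial ring is a domain. One
  \<open>b\<close> serves all \<open>l\<close>, since that power depends on the coefficients alone;
  this uniformity later turns infinitely many coefficient equations into one differential
  equation.\<close>

lemma specialise_linear_relations:
  fixes a :: "'i \<Rightarrow> 'a::idom poly" and q :: "'l \<Rightarrow> 'i \<Rightarrow> 'a poly"
  assumes "finite I" "\<exists>i\<in>I. a i \<noteq> 0" and rel: "\<And>l. (\<Sum>i\<in>I. a i * q l i) = 0"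
  shows "\<exists>b. (\<exists>i\<in>I. b i \<noteq> 0) \<and> (\<forall>l. (\<Sum>i\<in>I. b i * poly (q l i) c) = 0)"
proof -
  obtain m b where b: "\<And>i. i \<in> I \<Longrightarrow> a i = [:- c, 1:] ^ m * b i" "\<exists>i\<in>I. poly (b i) c \<noteq> 0"
    using factor_out_common_root[OF assms(1,2), of c] by blast
  have "(\<Sum>i\<in>I. poly (b i) c * poly (q l i) c) = 0" for l
  proof -
    have "[:- c, 1:] ^ m * (\<Sum>i\<in>I. b i * q l i) = (\<Sum>i\<in>I. a i * q l i)"
      by (simp add: sum_distrib_left b(1) mult.assoc)
    then have "(\<Sum>i\<in>I. b i * q l i) = 0" using rel by simp
    then have "poly (\<Sum>i\<in>I. b i * q l i) c = 0" by simp
    then show ?thesis by (simp add: poly_sum)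
  qed
  then show ?thesis using b(2) by (intro exI[of _ "\<lambda>i. poly (b i) c"]) blast
qed

lemma fps_deriv_iterate_nth:
  fixes f :: "'a::comm_ring_1 fps"
  shows "(fps_deriv ^^ k) f $ m = of_nat (\<Prod>i<k. m + i + 1) * f $ (m + k)"
proof (induction k arbitrary: m)
  case (Suc k)
  have "(\<Prod>i<k. Suc m + i + 1) * (m + 1) = (\<Prod>i<Suc k. m + i + 1)"
    by (subst prod.lessThan_Suc_shift) (simp add: mult.commute)
  then have "of_nat (\<Prod>i<Suc k. m + i + 1) = of_nat (m + 1) * (of_nat (\<Prod>i<k. Suc m + i + 1) :: 'a)"
    by (metis mult.commute of_nat_mult)
  then show ?case using Suc[of "Suc m"] by (simp add: mult.assoc)
qed auto

text \<open>The layer of \<open>fps_of_poly_xyt\<close> over one power of t. The t-coefficients of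
  the walk series lie in its image, so relations among them become relations among polynomials,
  where setting x = y = 1 makes sense.\<close>

definition fps_of_poly_xy :: "complex poly poly \<Rightarrow> complex fps fps" where
  "fps_of_poly_xy p = Abs_fps (\<lambda>i. Abs_fps (\<lambda>j. coeff (coeff p i) j))"

lemma fps_of_poly_xy_eq: "fps_of_poly_xy p = Abs_fps (\<lambda>i. fps_of_poly (coeff p i))"
  unfolding fps_of_poly_xy_def fps_of_poly_def ..

lemma fps_of_poly_xy_0 [simp]: "fps_of_poly_xy 0 = 0"
  by (simp add: fps_of_poly_xy_eq fps_eq_iff)

lemma fps_of_poly_xy_eq_0_iff [simp]: "fps_of_poly_xy p = 0 \<longleftrightarrow> p = 0"
proof
  assume "fps_of_poly_xy p = 0"
  then have "fps_of_poly_xy p $ i = 0" for i by simp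
  then have "coeff p i = 0" for i by (simp add: fps_of_poly_xy_eq)
  then show "p = 0" by (intro poly_eqI) simp
qed simp

lemma fps_of_poly_xy_add: "fps_of_poly_xy (p + q) = fps_of_poly_xy p + fps_of_poly_xy q"
  by (simp add: fps_of_poly_xy_def fps_eq_iff)

lemma fps_of_poly_xy_mult: "fps_of_poly_xy (p * q) = fps_of_poly_xy p * fps_of_poly_xy q"
  by (simp add: fps_of_poly_xy_def fps_eq_iff fps_mult_nth coeff_mult fps_sum_nth coeff_sum
        atMost_atLeast0)

lemma fps_of_poly_xy_sum: "fps_of_poly_xy (\<Sum>i\<in>A. f i) = (\<Sum>i\<in>A. fps_of_poly_xy (f i))"
  by (induction A rule: infinite_finite_induct) (auto simp: fps_of_poly_xy_add)

lemma fps_of_poly_xy_of_nat: "fps_of_poly_xy (of_nat n) = of_nat n"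
proof (induction n)
  case (Suc n)
  moreover have "fps_of_poly_xy 1 = 1"
    by (auto simp: fps_of_poly_xy_def fps_eq_iff coeff_1)
  ultimately show ?case by (simp add: fps_of_poly_xy_add)
qed auto

lemma fps_of_poly_xyt_nth: "fps_of_poly_xyt a $ n = fps_of_poly_xy (coeff a n)"
  by (simp add: fps_of_poly_xyt_def fps_of_poly_xy_def)

text \<open>Only the derivative in t is used, because it commutes with setting x = y = 1. The
  coefficients of t^l in a relation give infinitely many linear equations between the polynomials
  \<open>q n\<close>, all governed by the same finitely many coefficients of the
  \<open>a k\<close>.\<close>

lemma holonomic_xyt_imp_relation_eval:
  fixes q :: "nat \<Rightarrow> complex poly poly"
  assumes hol: "holonomic_xyt F" and q: "\<And>n. F $ n = fps_of_poly_xy (q n)"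
  shows "\<exists>N P. (\<exists>k\<le>N. P k \<noteq> 0) \<and>
    (\<Sum>k\<le>N. fps_of_poly (P k) * (fps_deriv ^^ k) (Abs_fps (\<lambda>n. poly (poly (q n) 1) 1))) = 0"
proof -
  have mult: "fps_of_poly_xyt (a * b) = fps_of_poly_xyt a * fps_of_poly_xyt b" for a b
    by (simp add: fps_of_poly_xyt_def fps_eq_iff fps_mult_nth coeff_mult fps_sum_nth coeff_sum
        atMost_atLeast0)
  have inj: "inj fps_of_poly_xyt"
    by (auto simp: inj_def fps_of_poly_xyt_def fps_eq_iff poly_eq_iff)
  have zero: "fps_of_poly_xyt 0 = 0" by (simp add: fps_of_poly_xyt_def fps_eq_iff)
  have one: "fps_of_poly_xyt 1 = 1" by (auto simp: fps_of_poly_xyt_def fps_eq_iff coeff_1)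
  have dt: "deriv_t = fps_deriv" by (auto simp: deriv_t_def)
  obtain N a where a: "\<exists>k\<le>N. a k \<noteq> 0" "(\<Sum>k\<le>N. fps_of_poly_xyt (a k) * (fps_deriv ^^ k) F) = 0"
    using holonomic_wrt_imp_relation[OF vector_space_ratfun_scale_xyt mult inj zero one
      hol[unfolded holonomic_xyt_def dt], of fps_deriv] by auto
  define c where "c k m = (\<Prod>i<k. m + i + 1 :: nat)" for k m
  define M where "M = Max ((\<lambda>k. degree (a k)) ` {..N})"
  have M: "coeff (a k) i = 0" if "k \<le> N" "i > M" for k i
  proof -
    have "degree (a k) \<le> M" unfolding M_def by (rule Max_ge) (use that in auto)
    then show ?thesis using that by (simp add: coeff_eq_0)
  qed
  define I where "I = {..N} \<times> {..M}"
  have fin: "finite I" by (simp add: I_def)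
  define A where "A = (\<lambda>(k, i). coeff (a k) i)"
  \<comment> \<open>The value 0 for \<open>i > l\<close> lets the equations for all \<open>l\<close>
    be sums over the same index set \<open>I\<close>.\<close>
  define r where "r l = (\<lambda>(k, i). if i \<le> l then of_nat (c k (l - i)) * q (l - i + k) else 0)" for l
  have cut: "(\<Sum>i=0..l. g i) = (\<Sum>i\<le>M. if i \<le> l then g i else 0)"
    if "\<And>i. i > M \<Longrightarrow> g i = 0" for l and g :: "nat \<Rightarrow> 'z::comm_monoid_add"
  proof -
    have "(\<Sum>i=0..l. g i) = (\<Sum>i\<in>{0..l} \<inter> {..M}. g i)"
      by (rule sum.mono_neutral_right) (use that in auto)
    also have "{0..l} \<inter> {..M} = {i \<in> {..M}. i \<le> l}" by auto
    also have "(\<Sum>i\<in>\<dots>. g i) = (\<Sum>i\<le>M. if i \<le> l then g i else 0)"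
      by (rule sum.inter_filter) auto
    finally show ?thesis .
  qed
  have rel: "(\<Sum>i\<in>I. A i * r l i) = 0" for l
  proof -
    have "0 = (\<Sum>k\<le>N. fps_of_poly_xyt (a k) * (fps_deriv ^^ k) F) $ l" by (simp add: a)
    also have "\<dots> = (\<Sum>k\<le>N. \<Sum>i=0..l. fps_of_poly_xy (coeff (a k) i) * (of_nat (c k (l - i)) * fps_of_poly_xy (q (l - i + k))))"
      by (simp add: fps_sum_nth fps_mult_nth fps_of_poly_xyt_nth fps_deriv_iterate_nth c_def q)
    also have "\<dots> = (\<Sum>k\<le>N. \<Sum>i=0..l. fps_of_poly_xy (coeff (a k) i * (of_nat (c k (l - i)) * q (l - i + k))))"
      by (simp add: fps_of_poly_xy_mult fps_of_poly_xy_of_nat)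
    also have "\<dots> = fps_of_poly_xy (\<Sum>k\<le>N. \<Sum>i=0..l. coeff (a k) i * (of_nat (c k (l - i)) * q (l - i + k)))"
      by (simp add: fps_of_poly_xy_sum)
    finally have "(\<Sum>k\<le>N. \<Sum>i=0..l. coeff (a k) i * (of_nat (c k (l - i)) * q (l - i + k))) = 0"
      by simp
    also have "(\<Sum>k\<le>N. \<Sum>i=0..l. coeff (a k) i * (of_nat (c k (l - i)) * q (l - i + k)))
        = (\<Sum>k\<le>N. \<Sum>i\<le>M. A (k, i) * r l (k, i))"
    proof (rule sum.cong[OF refl])
      fix k assume "k \<in> {..N}"
      then show "(\<Sum>i=0..l. coeff (a k) i * (of_nat (c k (l - i)) * q (l - i + k)))
        = (\<Sum>i\<le>M. A (k, i) * r l (k, i))"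
        by (subst cut) (auto simp: M A_def r_def intro!: sum.cong)
    qed
    finally show ?thesis by (simp add: I_def sum.cartesian_product case_prod_unfold)
  qed
  have A0: "\<exists>i\<in>I. A i \<noteq> 0"
  proof -
    obtain k where k: "k \<le> N" "a k \<noteq> 0" using a by blast
    then have "degree (a k) \<le> M" "lead_coeff (a k) \<noteq> 0" using M[of k "degree (a k)"] by force+
    then show ?thesis using k by (intro bexI[of _ "(k, degree (a k))"]) (auto simp: A_def I_def)
  qed
  \<comment> \<open>The outer polynomial variable is x: this specialisation sets x = 1, the next one
    y = 1.\<close>
  obtain b1 where b1: "\<exists>i\<in>I. b1 i \<noteq> 0" "\<And>l. (\<Sum>i\<in>I. b1 i * poly (r l i) 1) = 0"
    using specialise_linear_relations[where q = r and c = 1, OF fin A0 rel] by blast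
  obtain b where b: "\<exists>i\<in>I. b i \<noteq> 0" "\<And>l. (\<Sum>i\<in>I. b i * poly (poly (r l i) 1) 1) = 0"
    using specialise_linear_relations[where q = "\<lambda>l i. poly (r l i) 1" and c = 1, OF fin b1] by blast
  define P where "P k = (\<Sum>i\<le>M. monom (b (k, i)) i)" for k
  have coP: "coeff (P k) i = (if i \<le> M then b (k, i) else 0)" for k i
    by (simp add: P_def coeff_sum)
  show ?thesis
  proof (rule exI[of _ N], rule exI[of _ P], rule conjI)
    obtain k i where "b (k, i) \<noteq> 0" "k \<le> N" "i \<le> M" using b by (auto simp: I_def)
    then have "coeff (P k) i \<noteq> 0" by (simp add: coP)
    then show "\<exists>k\<le>N. P k \<noteq> 0" using \<open>k \<le> N\<close> by (metis coeff_0)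
    show "(\<Sum>k\<le>N. fps_of_poly (P k) * (fps_deriv ^^ k) (Abs_fps (\<lambda>n. poly (poly (q n) 1) 1))) = 0"
      (is "?s = 0")
    proof (rule fps_ext)
      fix l
      have "?s $ l = (\<Sum>k\<le>N. \<Sum>i=0..l. coeff (P k) i * (of_nat (c k (l - i)) * poly (poly (q (l - i + k)) 1) 1))"
        by (simp add: fps_sum_nth fps_mult_nth fps_deriv_iterate_nth c_def)
      also have "\<dots> = (\<Sum>k\<le>N. \<Sum>i\<le>M. b (k, i) * poly (poly (r l (k, i)) 1) 1)"
        by (rule sum.cong[OF refl], subst cut) (auto simp: coP r_def intro!: sum.cong)
      also have "\<dots> = 0" using b(2)[of l] by (simp add: I_def sum.cartesian_product case_prod_unfold)
      finally show "?s $ l = 0 $ l" by simp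
    qed
  qed
qed

lemma holonomic_t_imp_relation:
  assumes "holonomic_t F"
  shows "\<exists>N P. (\<exists>k\<le>N. P k \<noteq> 0) \<and> (\<Sum>k\<le>N. fps_of_poly (P k) * (fps_deriv ^^ k) F) = 0"
proof -
  have m: "fps_of_poly (a * b) = fps_of_poly a * (fps_of_poly b :: complex fps)" for a b
    by (rule fps_of_poly_mult)
  have i: "inj (fps_of_poly :: complex poly \<Rightarrow> _)"
    by (rule injI) simp
  have d: "(fps_deriv :: complex fps \<Rightarrow> _) \<in> {fps_deriv}" by blast
  show ?thesis
    by (fact holonomic_wrt_imp_relation[OF vector_space_ratfun_scale_t m i fps_of_poly_0
        fps_of_poly_1 assms[unfolded holonomic_t_def] d])
qed

section \<open>The functional equation of the walks\<close>

lemma quarter_walks_Suc: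
  "quarter_walks S (Suc n) = (\<lambda>(p, s). p @ [p ! n + s]) `
     (SIGMA p : quarter_walks S n. {s \<in> S. 0 \<le> fst (p ! n + s) \<and> 0 \<le> snd (p ! n + s)})"
  (is "?L = ?f ` ?X")
proof (intro equalityI subsetI)
  fix p assume p: "p \<in> ?L"
  then have len: "length p = Suc (Suc n)" by (simp add: quarter_walks_def)
  let ?q = "take (Suc n) p" and ?s = "p ! Suc n - p ! n"
  have "?q \<in> quarter_walks S n" "?s \<in> S"
    using p by (auto simp: quarter_walks_def)
  moreover have "0 \<le> fst (?q ! n + ?s)" "0 \<le> snd (?q ! n + ?s)"
    using p by (auto simp: quarter_walks_def)
  moreover have "p = ?q @ [?q ! n + ?s]"
    using len take_Suc_conv_app_nth[of "Suc n" p] by simp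
  ultimately show "p \<in> ?f ` ?X"
    by (intro image_eqI[where x = "(?q, ?s)"]) auto
next
  fix p assume "p \<in> ?f ` ?X"
  then show "p \<in> ?L"
    by (auto simp: quarter_walks_def nth_append less_Suc_eq le_Suc_eq)
qed

lemma inj_on_quarter_walks_extend:
  "inj_on (\<lambda>(p, s). p @ [p ! n + s]) (SIGMA p : quarter_walks S n. X p)"
  by (auto simp: inj_on_def)

text \<open>The coefficient of t^n in Q(x, y; t). Since 0^0 = 1, putting y = 0 keeps exactly the
  walks that end on the x-axis.\<close>

definition walk_sum :: "(int \<times> int) set \<Rightarrow> nat \<Rightarrow> 'a::comm_ring_1 \<Rightarrow> 'a \<Rightarrow> 'a" where
  "walk_sum S n x y = (\<Sum>p\<in>quarter_walks S n. x ^ nat (fst (p ! n)) * y ^ nat (snd (p ! n)))"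

abbreviation (input) three_steps :: "(int \<times> int) set" where
  "three_steps \<equiv> {(-1, 1), (1, 1), (1, -1)}"

lemma quarter_walks_nonneg:
  "p \<in> quarter_walks S n \<Longrightarrow> 0 \<le> fst (p ! n) \<and> 0 \<le> snd (p ! n)"
  by (auto simp: quarter_walks_def)

text \<open>The factor xy clears negative exponents, so the steps contribute x^2 y^2, x^2 and y^2.
  The subtracted terms forbid (1, -1) to walks ending on the x-axis and (-1, 1) to those ending on
  the y-axis.\<close>

lemma walk_sum_Suc:
  fixes x y :: "'a::comm_ring_1"
  shows "x * y * walk_sum three_steps (Suc n) x y =
    (x\<^sup>2 * y\<^sup>2 + x\<^sup>2 + y\<^sup>2) * walk_sum three_steps n x y
      - x\<^sup>2 * walk_sum three_steps n x 0 - y\<^sup>2 * walk_sum three_steps n 0 y"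
proof -
  let ?S = three_steps
  let ?X = "\<lambda>p. {s \<in> ?S. 0 \<le> fst (p ! n + s) \<and> 0 \<le> snd (p ! n + s)}"
  let ?m = "\<lambda>x y (e :: int \<times> int). x ^ nat (fst e) * y ^ nat (snd e) :: 'a"
  have step: "x * y * (\<Sum>s\<in>?X p. ?m x y (p ! n + s)) =
      (x\<^sup>2 * y\<^sup>2 + x\<^sup>2 + y\<^sup>2) * ?m x y (p ! n) - x\<^sup>2 * ?m x 0 (p ! n) - y\<^sup>2 * ?m 0 y (p ! n)"
    if p: "p \<in> quarter_walks ?S n" for p
  proof -
    obtain i j :: nat where ij: "p ! n = (int i, int j)"
      using quarter_walks_nonneg[OF p] by (metis nonneg_int_cases prod.exhaust_sel)
    have X: "?X p = (if i = 0 then {} else {(-1, 1)}) \<union> {(1, 1)} \<union> (if j = 0 then {} else {(1, -1)})"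
      using ij by auto
    have nat1: "nat (int m + 1) = Suc m" "nat (1 + int m) = Suc m"
      "nat (int m + 2) = Suc (Suc m)" for m by auto
    show ?thesis unfolding X unfolding ij
      by (cases i; cases j)
         (simp_all add: nat1 algebra_simps power2_eq_square)
  qed
  have "x * y * walk_sum ?S (Suc n) x y =
      x * y * (\<Sum>(p, s)\<in>(SIGMA p : quarter_walks ?S n. ?X p). ?m x y (p ! n + s))"
    unfolding walk_sum_def quarter_walks_Suc
    by (subst sum.reindex[OF inj_on_quarter_walks_extend])
       (auto intro!: sum.cong arg_cong[of _ _ "\<lambda>u. x * y * u"] simp: quarter_walks_def nth_append)
  also have "\<dots> = (\<Sum>p\<in>quarter_walks ?S n. x * y * (\<Sum>s\<in>?X p. ?m x y (p ! n + s)))"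
    by (subst sum.Sigma[symmetric]) (auto simp: finite_quarter_walks sum_distrib_left)
  also have "\<dots> = (\<Sum>p\<in>quarter_walks ?S n. (x\<^sup>2 * y\<^sup>2 + x\<^sup>2 + y\<^sup>2) * ?m x y (p ! n)
      - x\<^sup>2 * ?m x 0 (p ! n) - y\<^sup>2 * ?m 0 y (p ! n))"
    by (rule sum.cong[OF refl step])
  also have "\<dots> = (x\<^sup>2 * y\<^sup>2 + x\<^sup>2 + y\<^sup>2) * walk_sum ?S n x y
      - x\<^sup>2 * walk_sum ?S n x 0 - y\<^sup>2 * walk_sum ?S n 0 y"
    by (simp add: walk_sum_def sum_subtractf sum_distrib_left)
  finally show ?thesis .
qed

text \<open>Reflection in the diagonal preserves the step set. Hence both boundary terms of the
  functional equation involve one and the same function of one variable.\<close>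

lemma walk_sum_swap:
  fixes x y :: "'a::comm_ring_1"
  shows "walk_sum three_steps n x y = walk_sum three_steps n y x"
proof -
  have "map prod.swap p \<in> quarter_walks three_steps n" if "p \<in> quarter_walks three_steps n" for p
    using that by (auto simp: quarter_walks_def prod_eq_iff)
  then show ?thesis unfolding walk_sum_def
    by (intro sum.reindex_bij_witness[of _ "map prod.swap" "map prod.swap"])
       (auto simp: quarter_walks_def mult.commute o_def)
qed

lemma walk_sum_0 [simp]: "walk_sum S 0 x y = 1"
proof -
  have "quarter_walks S 0 = {[(0, 0)]}"
    by (auto simp: quarter_walks_def length_Suc_conv)
  then show ?thesis by (simp add: walk_sum_def)
qed

lemma walk_sum_1_1: "walk_sum S n 1 1 = of_nat (card (quarter_walks S n))"
  by (simp add: walk_sum_def)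

lemma walk_sum_nonneg:
  fixes x y :: real
  assumes "0 \<le> x" "0 \<le> y"
  shows "0 \<le> walk_sum S n x y"
  unfolding walk_sum_def by (intro sum_nonneg) (use assms in auto)

lemma card_quarter_walks_le: "card (quarter_walks three_steps n) \<le> 3 ^ n"
proof (induction n)
  case 0
  then show ?case using walk_sum_1_1[where ?'a=int, of three_steps 0] by simp
next
  case (Suc n)
  have "walk_sum three_steps (Suc n) 1 1 \<le> 3 * walk_sum three_steps n 1 (1::real)"
    using walk_sum_Suc[of 1 "1::real" n] walk_sum_nonneg[of 1 0 three_steps n]
      walk_sum_nonneg[of 0 1 three_steps n] by simp
  then have "card (quarter_walks three_steps (Suc n)) \<le> 3 * card (quarter_walks three_steps n)"
    unfolding walk_sum_1_1 by linarith
  then show ?case using Suc by simp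
qed

lemma walk_sum_le:
  fixes x y :: real
  assumes "0 \<le> x" "0 \<le> y" "x \<le> 1" "y \<le> 1"
  shows "walk_sum three_steps n x y \<le> 3 ^ n"
proof -
  have "walk_sum three_steps n x y \<le> (\<Sum>p\<in>quarter_walks three_steps n. 1)"
    unfolding walk_sum_def by (intro sum_mono mult_le_one power_le_one) (use assms in auto)
  also have "\<dots> \<le> 3 ^ n" using of_nat_mono[OF card_quarter_walks_le[of n], where ?'a=real] by simp
  finally show ?thesis .
qed

lemma summable_walk_sum:
  fixes x y t :: real
  assumes "0 \<le> x" "0 \<le> y" "x \<le> 1" "y \<le> 1" "0 \<le> t" "t < 1 / 3"
  shows "summable (\<lambda>n. walk_sum three_steps n x y * t ^ n)"
proof (rule summable_comparison_test')
  show "summable (\<lambda>n. (3 * t) ^ n)" using assms by (intro summable_geometric) auto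
  show "norm (walk_sum three_steps n x y * t ^ n) \<le> (3 * t) ^ n" for n
    using walk_sum_le[OF assms(1-4), of n] walk_sum_nonneg[OF assms(1,2), of three_steps n] assms
    by (simp add: abs_mult power_mult_distrib mult_right_mono)
qed

lemma walk_series_equation:
  fixes x y t :: real
  assumes xy: "0 \<le> x" "0 \<le> y" "x \<le> 1" "y \<le> 1" and t: "0 \<le> t" "t < 1 / 3"
  defines "Q \<equiv> \<lambda>x y. \<Sum>n. walk_sum three_steps n x y * t ^ n"
  shows "(x * y - t * (x\<^sup>2 * y\<^sup>2 + x\<^sup>2 + y\<^sup>2)) * Q x y = x * y - t * x\<^sup>2 * Q x 0 - t * y\<^sup>2 * Q y 0"
proof -
  note sm = summable_walk_sum[OF _ _ _ _ t]
  have s: "(\<lambda>n. walk_sum three_steps n x y * t ^ n) sums Q x y"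
    "(\<lambda>n. walk_sum three_steps n x 0 * t ^ n) sums Q x 0"
    "(\<lambda>n. walk_sum three_steps n 0 y * t ^ n) sums Q y 0"
    unfolding Q_def walk_sum_swap[of _ 0 y] by (intro summable_sums sm; use xy in simp)+
  have "(\<lambda>n. t * ((x\<^sup>2 * y\<^sup>2 + x\<^sup>2 + y\<^sup>2) * (walk_sum three_steps n x y * t ^ n)
      - x\<^sup>2 * (walk_sum three_steps n x 0 * t ^ n) - y\<^sup>2 * (walk_sum three_steps n 0 y * t ^ n)))
      sums (t * ((x\<^sup>2 * y\<^sup>2 + x\<^sup>2 + y\<^sup>2) * Q x y - x\<^sup>2 * Q x 0 - y\<^sup>2 * Q y 0))"
    by (intro sums_mult sums_diff s)
  moreover have "t * ((x\<^sup>2 * y\<^sup>2 + x\<^sup>2 + y\<^sup>2) * (walk_sum three_steps n x y * t ^ n)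
      - x\<^sup>2 * (walk_sum three_steps n x 0 * t ^ n) - y\<^sup>2 * (walk_sum three_steps n 0 y * t ^ n))
      = x * y * (walk_sum three_steps (Suc n) x y * t ^ Suc n)" for n
  proof -
    have "x * y * (walk_sum three_steps (Suc n) x y * t ^ Suc n)
        = t ^ Suc n * (x * y * walk_sum three_steps (Suc n) x y)" by simp
    also have "\<dots> = t ^ Suc n * ((x\<^sup>2 * y\<^sup>2 + x\<^sup>2 + y\<^sup>2) * walk_sum three_steps n x y
      - x\<^sup>2 * walk_sum three_steps n x 0 - y\<^sup>2 * walk_sum three_steps n 0 y)"
      by (simp only: walk_sum_Suc)
    finally show ?thesis by (simp add: algebra_simps)
  qed
  ultimately have "(\<lambda>n. x * y * (walk_sum three_steps (Suc n) x y * t ^ Suc n))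
      sums (t * ((x\<^sup>2 * y\<^sup>2 + x\<^sup>2 + y\<^sup>2) * Q x y - x\<^sup>2 * Q x 0 - y\<^sup>2 * Q y 0))" by simp
  moreover have "(\<lambda>n. x * y * (walk_sum three_steps (Suc n) x y * t ^ Suc n)) sums (x * y * (Q x y - 1))"
    by (intro sums_mult) (use s(1) in \<open>subst sums_Suc_iff, simp\<close>)
  ultimately have "x * y * (Q x y - 1) = t * ((x\<^sup>2 * y\<^sup>2 + x\<^sup>2 + y\<^sup>2) * Q x y - x\<^sup>2 * Q x 0 - y\<^sup>2 * Q y 0)"
    by (rule sums_unique2[symmetric])
  then show ?thesis by (simp add: algebra_simps)
qed

text \<open>On the kernel the functional equation reads x_n x_(n+1) = r_n + r_(n+1) with r_n = t
  x_n^2 Q(x_n, 0), so the alternating sum telescopes to r_0 = t Q(1, 0). At x = y = 1 the kernel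
  equals 1 - 3t, whence the factor on the left.\<close>

lemma counting_series_kernel_iteration:
  fixes t T :: real and x :: "nat \<Rightarrow> real"
  assumes t: "0 \<le> t" "t < 1 / 3"
    and x: "x 0 = 1" "\<And>n. 0 \<le> x n" "\<And>n. x n \<le> 1" "x \<longlonglongrightarrow> 0"
    and ker: "\<And>n. x n * x (Suc n) = t * ((x n)\<^sup>2 * (x (Suc n))\<^sup>2 + (x n)\<^sup>2 + (x (Suc n))\<^sup>2)"
    and T: "(\<lambda>n. (-1) ^ n * (x n * x (Suc n))) sums T"
  shows "(1 - 3 * t) * (\<Sum>n. of_nat (card (quarter_walks three_steps n)) * t ^ n) = 1 - 2 * T"
proof -
  define Q where "Q x y = (\<Sum>n. walk_sum three_steps n x y * t ^ n)" for x y :: real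
  have eq: "(x * y - t * (x\<^sup>2 * y\<^sup>2 + x\<^sup>2 + y\<^sup>2)) * Q x y = x * y - t * x\<^sup>2 * Q x 0 - t * y\<^sup>2 * Q y 0"
    if "0 \<le> x" "0 \<le> y" "x \<le> 1" "y \<le> 1" for x y
    unfolding Q_def by (rule walk_series_equation[OF that t])
  have step: "x n * x (Suc n) = t * (x n)\<^sup>2 * Q (x n) 0 + t * (x (Suc n))\<^sup>2 * Q (x (Suc n)) 0" for n
    using eq[of "x n" "x (Suc n)"] x(2,3) ker[of n] by simp
  have part: "(\<Sum>k<n. (-1) ^ k * (x k * x (Suc k))) = t * Q 1 0 - (-1) ^ n * (t * (x n)\<^sup>2 * Q (x n) 0)" for n
  proof (induction n)
    case (Suc n)
    show ?case by (simp only: sum.lessThan_Suc Suc step[of n]) (simp add: algebra_simps)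
  qed (simp add: x(1))
  \<comment> \<open>The bound is uniform in \<open>y\<close>; with x_n tending to 0 it makes the
    remainder of the telescoping sum vanish.\<close>
  have bd: "0 \<le> Q y 0 \<and> Q y 0 \<le> 1 / (1 - 3 * t)" if "0 \<le> y" "y \<le> 1" for y
  proof -
    have sm: "summable (\<lambda>n. walk_sum three_steps n y 0 * t ^ n)"
      using that t by (intro summable_walk_sum) auto
    have "0 \<le> Q y 0" unfolding Q_def
      by (rule suminf_nonneg[OF sm]) (use that t in \<open>auto intro!: mult_nonneg_nonneg walk_sum_nonneg\<close>)
    moreover have "Q y 0 \<le> (\<Sum>n. (3 * t) ^ n)" unfolding Q_def
    proof (rule suminf_le[OF _ sm])
      show "summable (\<lambda>n. (3 * t) ^ n)" using t by (intro summable_geometric) auto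
      show "walk_sum three_steps n y 0 * t ^ n \<le> (3 * t) ^ n" for n
        using walk_sum_le[of y 0 n] that t by (simp add: power_mult_distrib mult_right_mono)
    qed
    moreover have "(\<Sum>n. (3 * t) ^ n) = 1 / (1 - 3 * t)" using t by (intro suminf_geometric) auto
    ultimately show ?thesis by simp
  qed
  have lim: "(\<lambda>n. (-1) ^ n * (t * (x n)\<^sup>2 * Q (x n) 0)) \<longlonglongrightarrow> 0"
  proof (rule Lim_null_comparison)
    show "\<forall>\<^sub>F n in sequentially. norm ((-1) ^ n * (t * (x n)\<^sup>2 * Q (x n) 0)) \<le> t * (x n)\<^sup>2 * (1 / (1 - 3 * t))"
    proof (intro always_eventually allI)
      fix n
      have "norm ((-1) ^ n * (t * (x n)\<^sup>2 * Q (x n) 0)) = t * (x n)\<^sup>2 * Q (x n) 0"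
        using t bd[OF x(2,3), of n] by (simp add: abs_mult power_abs)
      also have "\<dots> \<le> t * (x n)\<^sup>2 * (1 / (1 - 3 * t))"
        using t bd[OF x(2,3), of n] by (intro mult_left_mono) auto
      finally show "norm ((-1) ^ n * (t * (x n)\<^sup>2 * Q (x n) 0)) \<le> t * (x n)\<^sup>2 * (1 / (1 - 3 * t))" .
    qed
    show "(\<lambda>n. t * (x n)\<^sup>2 * (1 / (1 - 3 * t))) \<longlonglongrightarrow> 0"
      using x(4) t by (auto intro!: tendsto_eq_intros)
  qed
  have "(\<lambda>n. \<Sum>k<n. (-1) ^ k * (x k * x (Suc k))) \<longlonglongrightarrow> t * Q 1 0"
    unfolding part using tendsto_diff[OF tendsto_const lim, of "t * Q 1 0"] by (simp only: diff_zero)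
  then have "T = t * Q 1 0" using T LIMSEQ_unique unfolding sums_def by blast
  moreover have "(1 - 3 * t) * Q 1 1 = 1 - 2 * (t * Q 1 0)"
    using eq[of 1 1] by (simp add: algebra_simps)
  ultimately show ?thesis by (simp add: Q_def walk_sum_1_1)
qed

lemma quarter_gf_nth_polynomial:
  assumes "finite S"
  shows "\<exists>q. \<forall>n. quarter_gf S $ n = fps_of_poly_xy (q n) \<and>
    poly (poly (q n) 1) 1 = quarter_counting_gf S $ n"
proof -
  define q :: "nat \<Rightarrow> complex poly poly" where
    "q n = (\<Sum>p\<in>quarter_walks S n. monom (monom 1 (nat (snd (p ! n)))) (nat (fst (p ! n))))" for n
  show ?thesis
  proof (intro exI[of _ q] allI conjI)
    fix n
    have "coeff (coeff (q n) i) j = of_nat (quarter_count S n i j)" for i j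
    proof -
      have "coeff (coeff (q n) i) j =
          (\<Sum>p\<in>quarter_walks S n. if p ! n = (int i, int j) then 1 else 0)"
        unfolding q_def coeff_sum
        by (rule sum.cong) (auto simp: prod_eq_iff dest: quarter_walks_nonneg)
      also have "\<dots> = (\<Sum>p\<in>{p \<in> quarter_walks S n. p ! n = (int i, int j)}. 1)"
        by (rule sum.inter_filter[symmetric]) (simp add: finite_quarter_walks assms)
      finally show ?thesis by (simp add: quarter_count_def)
    qed
    then show "quarter_gf S $ n = fps_of_poly_xy (q n)"
      by (simp add: quarter_gf_def fps_of_poly_xy_def)
    show "poly (poly (q n) 1) 1 = quarter_counting_gf S $ n"
      by (simp add: quarter_counting_gf_nth[OF assms] q_def poly_sum poly_monom)
  qed
qed

section \<open>Differential equations and poles\<close>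

lemma holomorphic_on_poly_compose [holomorphic_intros]:
  fixes f :: "complex \<Rightarrow> complex"
  assumes "f holomorphic_on A"
  shows "(\<lambda>z. poly p (f z)) holomorphic_on A"
  by (induction p) (auto intro!: holomorphic_intros assms)

text \<open>The operator taking h to h'/t' is d/dt transported along \<open>t\<close>. On
  \<open>U\<close> it reproduces the derivatives of \<open>g\<close>, and the identity theorem
  spreads the equation over \<open>\<Omega>\<close>. Outside \<open>U\<close>, \<open>f\<close> is
  not assumed to be a function of \<open>t\<close>.\<close>

lemma continue_ode_along_parametrisation:
  fixes t f g :: "complex \<Rightarrow> complex" and P :: "nat \<Rightarrow> complex poly"
  assumes \<Omega>: "open \<Omega>" "connected \<Omega>" and t: "t holomorphic_on \<Omega>" and f: "f holomorphic_on \<Omega>"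
    and t': "\<And>s. s \<in> \<Omega> \<Longrightarrow> deriv t s \<noteq> 0"
    and V: "open V" "g holomorphic_on V"
    and U: "open U" "U \<noteq> {}" "U \<subseteq> \<Omega>" "t ` U \<subseteq> V" "\<And>s. s \<in> U \<Longrightarrow> f s = g (t s)"
    and ode: "\<And>z. z \<in> V \<Longrightarrow> (\<Sum>k\<le>N. poly (P k) z * (deriv ^^ k) g z) = 0"
    and s: "s \<in> \<Omega>"
  shows "(\<Sum>k\<le>N. poly (P k) (t s) * ((\<lambda>h s. deriv h s / deriv t s) ^^ k) f s) = 0"
proof -
  define F where "F k = ((\<lambda>h s. deriv h s / deriv t s) ^^ k) f" for k
  have F0: "F 0 = f" and FS: "F (Suc k) = (\<lambda>s. deriv (F k) s / deriv t s)" for k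
    by (simp_all add: F_def)
  have hF: "F k holomorphic_on \<Omega>" for k
    by (induction k) (auto simp: F0 FS f t t' \<Omega> intro!: holomorphic_intros)
  have FU: "F k s = (deriv ^^ k) g (t s)" if "s \<in> U" for k s
    using that
  proof (induction k arbitrary: s)
    case (Suc k)
    have tV: "t s \<in> V" "s \<in> \<Omega>" using U Suc.prems by auto
    have "((deriv ^^ k) g has_field_derivative deriv ((deriv ^^ k) g) (t s)) (at (t s))"
      using V tV by (intro holomorphic_derivI[OF holomorphic_higher_deriv]) auto
    moreover have "(t has_field_derivative deriv t s) (at s)"
      using t \<Omega> tV by (intro holomorphic_derivI) auto
    ultimately have der: "((\<lambda>s. (deriv ^^ k) g (t s)) has_field_derivative
        deriv ((deriv ^^ k) g) (t s) * deriv t s) (at s)"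
      by (rule DERIV_chain2)
    have ev: "\<forall>\<^sub>F x in nhds s. F k x = (deriv ^^ k) g (t x)"
      using Suc U(1) by (auto simp: eventually_nhds)
    have "(F k has_field_derivative deriv ((deriv ^^ k) g) (t s) * deriv t s) (at s)"
      by (rule iffD2[OF DERIV_cong_ev[OF refl ev refl] der])
    then have "deriv (F k) s = deriv ((deriv ^^ k) g) (t s) * deriv t s" by (rule DERIV_imp_deriv)
    then show ?case using t'[OF tV(2)] by (simp add: FS)
  qed (simp add: F0 U)
  define H where "H s = (\<Sum>k\<le>N. poly (P k) (t s) * F k s)" for s
  have "H holomorphic_on \<Omega>" unfolding H_def
    using hF t by (intro holomorphic_intros) auto
  moreover have "H s = 0" if "s \<in> U" for s
    using ode[of "t s"] U that by (auto simp: H_def FU)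
  ultimately have "H s = 0"
    using analytic_continuation_open[of U \<Omega> H "\<lambda>_. 0"] U \<Omega> s by auto
  then show ?thesis by (simp add: H_def F_def)
qed

text \<open>Each application of $\frac{1}{t'}\frac{d}{ds}$ raises the order of a pole by exactly one,
  so the term of highest order cannot be cancelled.\<close>

lemma leading_coefficient_vanishes_at_pole:
  fixes t f h :: "complex \<Rightarrow> complex" and P :: "nat \<Rightarrow> complex poly"
  assumes r: "r > 0" and t: "t holomorphic_on ball z0 r"
    and t': "\<And>s. s \<in> ball z0 r \<Longrightarrow> deriv t s \<noteq> 0"
    and h: "h holomorphic_on ball z0 r" "h z0 \<noteq> 0"
    and m: "m > 0" and f: "\<And>s. s \<in> ball z0 r - {z0} \<Longrightarrow> f s = h s / (s - z0) ^ m"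
    and ode: "\<And>s. s \<in> ball z0 r - {z0} \<Longrightarrow>
      (\<Sum>k\<le>N. poly (P k) (t s) * ((\<lambda>h s. deriv h s / deriv t s) ^^ k) f s) = 0"
  shows "poly (P N) (t z0) = 0"
proof -
  define F where "F k = ((\<lambda>h s. deriv h s / deriv t s) ^^ k) f" for k
  have F0: "F 0 = f" and FS: "F (Suc k) = (\<lambda>s. deriv (F k) s / deriv t s)" for k
    by (simp_all add: F_def)
  have "\<exists>h. h holomorphic_on ball z0 r \<and> h z0 \<noteq> 0 \<and>
      (\<forall>s\<in>ball z0 r - {z0}. F k s = h s / (s - z0) ^ (m + k))" for k
  proof (induction k)
    case 0
    then show ?case using h f by (auto simp: F0)
  next
    case (Suc k)
    then obtain h where h: "h holomorphic_on ball z0 r" "h z0 \<noteq> 0"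
      "\<And>s. s \<in> ball z0 r - {z0} \<Longrightarrow> F k s = h s / (s - z0) ^ (m + k)" by blast
    \<comment> \<open>The numerator of the derivative after one cancellation; at \<open>z0\<close>
      it is -(m + k) h(z0) / t'(z0), nonzero because m > 0.\<close>
    define h' where "h' s = (deriv h s * (s - z0) - of_nat (m + k) * h s) / deriv t s" for s
    have "h' holomorphic_on ball z0 r" unfolding h'_def
      using h t t' by (intro holomorphic_intros) auto
    moreover have "of_nat (m + k) \<noteq> (0::complex)" using m unfolding of_nat_eq_0_iff by simp
    then have "h' z0 \<noteq> 0" using h t' r by (auto simp: h'_def simp del: of_nat_add)
    moreover have "F (Suc k) s = h' s / (s - z0) ^ (m + Suc k)" if s: "s \<in> ball z0 r - {z0}" for s
    proof -
      have "(h has_field_derivative deriv h s) (at s)"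
        using h s by (intro holomorphic_derivI) auto
      then have der: "((\<lambda>s. h s / (s - z0) ^ (m + k)) has_field_derivative
          (deriv h s * (s - z0) ^ (m + k) - h s * (of_nat (m + k) * (s - z0) ^ (m + k - 1)))
            / ((s - z0) ^ (m + k) * (s - z0) ^ (m + k))) (at s)"
        using s by (auto intro!: derivative_eq_intros)
      have ev: "\<forall>\<^sub>F x in nhds s. F k x = h x / (x - z0) ^ (m + k)"
        unfolding eventually_nhds using s h(3)
        by (intro exI[of _ "ball z0 r - {z0}"]) (auto intro: open_delete)
      have "(F k has_field_derivative
          (deriv h s * (s - z0) ^ (m + k) - h s * (of_nat (m + k) * (s - z0) ^ (m + k - 1)))
            / ((s - z0) ^ (m + k) * (s - z0) ^ (m + k))) (at s)"
        by (rule iffD2[OF DERIV_cong_ev[OF refl ev refl] der])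
      then have "deriv (F k) s =
          (deriv h s * (s - z0) ^ (m + k) - h s * (of_nat (m + k) * (s - z0) ^ (m + k - 1)))
            / ((s - z0) ^ (m + k) * (s - z0) ^ (m + k))" by (rule DERIV_imp_deriv)
      also have "\<dots> = (deriv h s * (s - z0) - of_nat (m + k) * h s) / (s - z0) ^ (m + Suc k)"
      proof -
        obtain j where j: "m + k = Suc j" using m by (cases "m + k") auto
        have "(d * w ^ Suc j - e * (of_nat (Suc j) * w ^ (Suc j - 1))) / (w ^ Suc j * w ^ Suc j)
            = (d * w - of_nat (Suc j) * e) / w ^ Suc (Suc j)" if "w \<noteq> 0" for d e w :: complex
          using that by (simp add: field_simps)
        then show ?thesis unfolding add_Suc_right j using s by simp
      qed
      finally show ?thesis by (simp add: FS h'_def)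
    qed
    ultimately show ?case by blast
  qed
  then obtain h where h: "\<And>k. h k holomorphic_on ball z0 r" "\<And>k. h k z0 \<noteq> 0"
    "\<And>k s. s \<in> ball z0 r - {z0} \<Longrightarrow> F k s = h k s / (s - z0) ^ (m + k)"
    by metis
  \<comment> \<open>The equation multiplied by (s - z0)^(m + N). Continuity gives H(z0) = 0, while
    only the term k = N survives at \<open>z0\<close>.\<close>
  define H where "H s = (\<Sum>k\<le>N. poly (P k) (t s) * (h k s * (s - z0) ^ (N - k)))" for s
  have H0: "H s = 0" if s: "s \<in> ball z0 r - {z0}" for s
  proof -
    have "H s = (\<Sum>k\<le>N. (s - z0) ^ (m + N) * (poly (P k) (t s) * F k s))"
      unfolding H_def
    proof (rule sum.cong[OF refl])
      fix k assume "k \<in> {..N}"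
      then have "(s - z0) ^ (m + N) = (s - z0) ^ (m + k) * (s - z0) ^ (N - k)"
        by (simp flip: power_add)
      then show "poly (P k) (t s) * (h k s * (s - z0) ^ (N - k))
          = (s - z0) ^ (m + N) * (poly (P k) (t s) * F k s)"
        using s by (simp add: h(3)[OF s])
    qed
    also have "\<dots> = 0" using ode[OF s] by (simp add: F_def flip: sum_distrib_left)
    finally show ?thesis .
  qed
  have "H holomorphic_on ball z0 r" unfolding H_def
    using h t by (intro holomorphic_intros) auto
  then have "continuous_on (ball z0 r) H" by (rule holomorphic_on_imp_continuous_on)
  then have "H \<midarrow>z0\<rightarrow> H z0"
    using r by (simp add: continuous_on_eq_continuous_at isCont_def)
  moreover have "H \<midarrow>z0\<rightarrow> 0"
  proof (rule tendsto_eventually)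
    show "\<forall>\<^sub>F s in at z0. H s = 0"
      unfolding eventually_at using r H0 by (intro exI[of _ r]) (auto simp: dist_commute)
  qed
  ultimately have "H z0 = 0" by (rule LIM_unique)
  moreover have "H z0 = (\<Sum>k\<in>{N}. poly (P k) (t z0) * (h k z0 * (z0 - z0) ^ (N - k)))"
    unfolding H_def by (rule sum.mono_neutral_right) auto
  ultimately show ?thesis using h(2)[of N] by simp
qed

section \<open>Uniformisation of the kernel\<close>

lemma divide_le_self:
  fixes a d :: real
  assumes "0 \<le> a" "1 \<le> d"
  shows "a / d \<le> a"
  using divide_left_mono[of 1 d a] assms by simp

text \<open>Here \<open>a\<close> is the uniformising parameter of the kernel curve and
  multiplication by \<open>q\<close> leads from one iterate to the next; the factor 1 + c normalises
  x = 1 at a = 1.\<close>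

lemma kernel_uniformisation:
  fixes a c q :: real
  assumes rel: "(1 + c)\<^sup>2 * q\<^sup>2 = c * (1 - q\<^sup>2)\<^sup>2" and pos: "0 < a" "0 < c" "0 < q"
  defines "x \<equiv> (1 + c) * a / (1 + c * a\<^sup>2)" and "y \<equiv> (1 + c) * (a * q) / (1 + c * (a * q)\<^sup>2)"
  shows "x * y = q / (1 + q\<^sup>2) * (x\<^sup>2 * y\<^sup>2 + x\<^sup>2 + y\<^sup>2)"
proof -
  define d e where "d = 1 + c * a\<^sup>2" and "e = 1 + c * (a * q)\<^sup>2"
  have nz: "d > 0" "e > 0" "1 + q\<^sup>2 > 0" using pos by (auto simp: d_def e_def add_pos_nonneg)
  have xd: "x = (1 + c) * a / d" and ye: "y = (1 + c) * (a * q) / e" by (simp_all add: x_def y_def d_def e_def)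
  \<comment> \<open>What is left of the kernel equation after removing the common factor (1 + c)^2
    a^2 q / (d e)^2; this is where \<open>rel\<close> enters.\<close>
  have key: "d * e * (1 + q\<^sup>2) = a\<^sup>2 * ((1 + c)\<^sup>2 * q\<^sup>2) + d\<^sup>2 * q\<^sup>2 + e\<^sup>2"
    unfolding rel d_def e_def by algebra
  have "x * y * (1 + q\<^sup>2) = (1 + c)\<^sup>2 * a\<^sup>2 * q / (d\<^sup>2 * e\<^sup>2) * (d * e * (1 + q\<^sup>2))"
    using nz by (simp add: xd ye field_simps power2_eq_square)
  also have "\<dots> = q * (x\<^sup>2 * y\<^sup>2 + x\<^sup>2 + y\<^sup>2)"
    unfolding key using nz by (simp add: xd ye field_simps power2_eq_square)
  finally show ?thesis using nz by (simp add: field_simps)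
qed

text \<open>Partial fractions: \<open>rel\<close> turns the numerator into a multiple of c a^2 (1 -
  q^2), which is a combination of the two denominators. Products of successive iterates become
  differences of one sequence, and the kernel sum becomes a Lambert series.\<close>

lemma kernel_product_telescopes:
  fixes a c q :: real
  assumes rel: "(1 + c)\<^sup>2 * q\<^sup>2 = c * (1 - q\<^sup>2)\<^sup>2" and pos: "0 < a" "0 < c" "0 < q"
  shows "(1 + c) * a / (1 + c * a\<^sup>2) * ((1 + c) * (a * q) / (1 + c * (a * q)\<^sup>2)) =
    (1 - q\<^sup>2) / q * (c * a\<^sup>2 / (1 + c * a\<^sup>2) - c * (a * q)\<^sup>2 / (1 + c * (a * q)\<^sup>2))"
proof -
  define d e where "d = 1 + c * a\<^sup>2" and "e = 1 + c * (a * q)\<^sup>2"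
  have nz: "d > 0" "e > 0" using pos by (auto simp: d_def e_def add_pos_nonneg)
  have "(1 + c) * a / d * ((1 + c) * (a * q) / e) = a\<^sup>2 * ((1 + c)\<^sup>2 * q\<^sup>2) / (q * d * e)"
    using nz pos by (simp add: field_simps power2_eq_square)
  also have "\<dots> = (1 - q\<^sup>2) / q * ((c * a\<^sup>2 * (1 - q\<^sup>2)) / (d * e))"
    unfolding rel using nz pos by (simp add: field_simps power2_eq_square)
  also have "c * a\<^sup>2 * (1 - q\<^sup>2) = c * a\<^sup>2 * e - c * (a * q)\<^sup>2 * d"
    unfolding d_def e_def by algebra
  also have "\<dots> / (d * e) = c * a\<^sup>2 / d - c * (a * q)\<^sup>2 / e"
    using nz by (simp add: field_simps)
  finally show ?thesis by (simp add: d_def e_def)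
qed

text \<open>With e_n = c q^(2n) / (1 + c q^(2n)), the sum of (-1)^n (e_n - e_(n+1)) is e_0 minus
  twice the sum of (-1)^k e_(k+1). The bounds on \<open>c\<close> and \<open>q\<close> give (1 + c)
  q < 3/8, which keeps the iterates in [0, 1], and t <= q < 1/3.\<close>

lemma counting_series_uniformised:
  fixes c q :: real
  assumes rel: "(1 + c)\<^sup>2 * q\<^sup>2 = c * (1 - q\<^sup>2)\<^sup>2"
    and c: "0 < c" "c < 1 / 2" and q: "0 < q" "q < 1 / 4"
  defines "t \<equiv> q / (1 + q\<^sup>2)" and "p \<equiv> q\<^sup>2"
  shows "(1 - 3 * t) * (\<Sum>n. of_nat (card (quarter_walks three_steps n)) * t ^ n) =
    1 - 2 * ((1 - p) / q * (c / (1 + c) - 2 * (\<Sum>k. (-1) ^ k * (c * p * p ^ k / (1 + c * p * p ^ k)))))"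
proof (rule counting_series_kernel_iteration)
  define x where "x n = (1 + c) * q ^ n / (1 + c * (q ^ n)\<^sup>2)" for n
  define e where "e n = c * (q ^ n)\<^sup>2 / (1 + c * (q ^ n)\<^sup>2)" for n
  have xS: "x (Suc n) = (1 + c) * (q ^ n * q) / (1 + c * (q ^ n * q)\<^sup>2)" for n
    by (simp add: x_def mult.commute)
  have "t \<le> q" unfolding t_def using q by (intro divide_le_self) auto
  then show "0 \<le> t" "t < 1 / 3" using q by (auto simp: t_def)
  show "x 0 = 1" using c by (simp add: x_def)
  have den: "1 + c * (q ^ n)\<^sup>2 \<ge> 1" for n using c by simp
  have den0: "0 < 1 + c * (q ^ n)\<^sup>2" for n using den[of n] by linarith
  show x0: "0 \<le> x n" for n
    unfolding x_def by (intro divide_nonneg_pos mult_nonneg_nonneg den0) (use c q in auto)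
  have xle: "x n \<le> (1 + c) * q ^ n" for n
  proof -
    have "(1 + c) * q ^ n / (1 + c * (q ^ n)\<^sup>2) \<le> (1 + c) * q ^ n"
      by (rule divide_le_self[OF _ den]) (use c q in auto)
    then show ?thesis by (simp add: x_def)
  qed
  show "x n \<le> 1" for n
  proof (cases n)
    case (Suc m)
    have "q ^ n \<le> q" using q by (simp add: Suc power_Suc_le_self power_le_one mult_left_le)
    then have "(1 + c) * q ^ n \<le> (3 / 2) * (1 / 4)" using c q by (intro mult_mono) auto
    then show ?thesis using xle[of n] by linarith
  qed (use \<open>x 0 = 1\<close> in simp)
  have "(\<lambda>n. (1 + c) * q ^ n) \<longlonglongrightarrow> 0"
    using LIMSEQ_power_zero[of q] q by (intro tendsto_mult_right_zero) auto
  then show "x \<longlonglongrightarrow> 0"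
    by (rule Lim_null_comparison[rotated]) (use x0 xle in auto)
  show "x n * x (Suc n) = t * ((x n)\<^sup>2 * (x (Suc n))\<^sup>2 + (x n)\<^sup>2 + (x (Suc n))\<^sup>2)" for n
    unfolding xS unfolding x_def t_def by (rule kernel_uniformisation[OF rel]) (use c q in auto)
  have eS: "e (Suc n) = c * (q ^ n * q)\<^sup>2 / (1 + c * (q ^ n * q)\<^sup>2)" for n
    by (simp add: e_def mult.commute)
  have tele: "x n * x (Suc n) = (1 - p) / q * (e n - e (Suc n))" for n
    unfolding xS eS unfolding x_def e_def p_def
    by (rule kernel_product_telescopes[OF rel]) (use c q in auto)
  have e_alt: "e (Suc k) = c * p * p ^ k / (1 + c * p * p ^ k)" for k
    by (simp add: e_def p_def power_mult_distrib algebra_simps flip: power_mult)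
  have "summable (\<lambda>k. (-1) ^ k * e k)"
  proof (rule summable_comparison_test')
    show "summable (\<lambda>k. c * p ^ k)"
      using q by (intro summable_mult summable_geometric) (auto simp: p_def power_less_one_iff abs_less_iff)
    fix k
    have "norm ((-1) ^ k * e k) = c * (q ^ k)\<^sup>2 / (1 + c * (q ^ k)\<^sup>2)"
      unfolding e_def norm_mult norm_divide using c q den0[of k] by simp
    also have "\<dots> \<le> c * (q ^ k)\<^sup>2"
      by (rule divide_le_self[OF _ den]) (use c in auto)
    finally show "norm ((-1) ^ k * e k) \<le> c * p ^ k"
      by (simp add: p_def mult.commute flip: power_mult)
  qed
  then obtain E where E: "(\<lambda>k. (-1) ^ k * e k) sums E" by (auto simp: summable_def)
  then have "(\<lambda>k. (-1) ^ Suc k * e (Suc k)) sums (E - e 0)" by (subst sums_Suc_iff) simp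
  then have E': "(\<lambda>k. (-1) ^ k * e (Suc k)) sums (e 0 - E)"
    using sums_minus by fastforce
  have S: "(\<lambda>n. (1 - p) / q * ((-1) ^ n * e n - (-1) ^ n * e (Suc n))) sums ((1 - p) / q * (E - (e 0 - E)))"
    by (intro sums_mult sums_diff E E')
  have E2: "E - (e 0 - E) = e 0 - 2 * (\<Sum>k. (-1) ^ k * e (Suc k))"
    using sums_unique[OF E'] by simp
  have e0: "e 0 = c / (1 + c)" by (simp add: e_def)
  have alt: "(-1) ^ n * (x n * x (Suc n)) = (1 - p) / q * ((-1) ^ n * e n - (-1) ^ n * e (Suc n))" for n
    unfolding tele by (simp only: right_diff_distrib mult.left_commute)
  show "(\<lambda>n. (-1) ^ n * (x n * x (Suc n))) sums
    ((1 - p) / q * (c / (1 + c) - 2 * (\<Sum>k. (-1) ^ k * (c * p * p ^ k / (1 + c * p * p ^ k)))))"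
    unfolding alt using S[unfolded E2, unfolded e0] by (simp only: e_alt)
qed

text \<open>\<open>nome\<close>, \<open>shift\<close> and \<open>tpar\<close> are $p$, $v$ and $t$ as functions of $s$.\<close>

definition nome :: "complex \<Rightarrow> complex" where
  "nome s = s\<^sup>2 * (1 - s\<^sup>2) / (1 + s\<^sup>2)"

definition shift :: "complex \<Rightarrow> complex" where
  "shift s = ((1 - s\<^sup>2) / (1 + s\<^sup>2))\<^sup>2"

definition tpar :: "complex \<Rightarrow> complex" where
  "tpar s = s * csqrt (1 - s ^ 4) / (1 + 2 * s\<^sup>2 - s ^ 4)"

definition lambert_term :: "nat \<Rightarrow> complex \<Rightarrow> complex" where
  "lambert_term k s = (-1) ^ k * (shift s * nome s ^ k / (1 + shift s * nome s ^ k))"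

text \<open>The value from \<open>counting_series_uniformised\<close> in terms of s: (1 - s^2) / (1
  + s^4) is c / (1 + c), and the factor before it is (1 - p) / q with q eliminated in favour of t,
  so that the only square root sits in \<open>tpar\<close>.\<close>

definition counting_cont :: "complex \<Rightarrow> complex" where
  "counting_cont s = (1 - 2 * ((1 + s ^ 4) / (tpar s * (1 + 2 * s\<^sup>2 - s ^ 4)) *
     ((1 - s\<^sup>2) / (1 + s ^ 4) - 2 * (\<Sum>k. lambert_term k s)))) / (1 - 3 * tpar s)"

lemma fps_conv_radius_counting_gf: "fps_conv_radius (quarter_counting_gf three_steps) \<ge> 1 / 3"
  unfolding fps_conv_radius_def
proof (rule conv_radius_geI_ex')
  fix r :: real assume r: "0 < r" "ereal r < 1 / 3"
  have "ereal r < ereal (1 / 3)" using r(2) by (simp add: one_ereal_def)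
  then have r3: "r < 1 / 3" by simp
  show "summable (\<lambda>n. fps_nth (quarter_counting_gf three_steps) n * of_real r ^ n)"
  proof (rule summable_comparison_test')
    show "summable (\<lambda>n. (3 * r) ^ n)" using r r3 by (intro summable_geometric) auto
    show "norm (fps_nth (quarter_counting_gf three_steps) n * of_real r ^ n) \<le> (3 * r) ^ n" for n
      using walk_sum_le[of 1 1 n] r
      by (simp add: quarter_counting_gf_nth norm_mult norm_power power_mult_distrib mult_right_mono walk_sum_1_1)
  qed
qed

text \<open>Agreement on one real interval is enough for the identity theorem. The interval is close
  to s = 1, where q and c tend to 0, so that c < 1/2 and q < 1/4 hold on it.\<close>

lemma counting_gf_eq_counting_cont_real:
  fixes s :: real
  assumes s: "47 / 50 < s" "s < 24 / 25"
  shows "norm (tpar (of_real s)) < 1 / 3"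
    "eval_fps (quarter_counting_gf three_steps) (tpar (of_real s)) = counting_cont (of_real s)"
proof -
  define z where "z = s\<^sup>2"
  have "(47 / 50)\<^sup>2 < s\<^sup>2" "s\<^sup>2 < (24 / 25)\<^sup>2" using s by (auto intro!: power_strict_mono)
  then have z: "88 / 100 < z" "z < 93 / 100" by (auto simp: z_def power2_eq_square)
  define c where "c = (1 - z) / (z * (1 + z))"
  define q where "q = s * sqrt (1 - s ^ 4) / (1 + s\<^sup>2)"
  have s4: "s ^ 4 = z\<^sup>2" by (simp add: z_def)
  have "z\<^sup>2 < 1" using z by (simp add: power_less_one_iff abs_less_iff)
  have q2: "q\<^sup>2 = z * (1 - z) / (1 + z)"
  proof -
    have "q\<^sup>2 = z * (1 - z\<^sup>2) / (1 + z)\<^sup>2"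
      using \<open>z\<^sup>2 < 1\<close> by (simp add: q_def s4 power_mult_distrib power_divide flip: z_def)
    also have "1 - z\<^sup>2 = (1 - z) * (1 + z)" by algebra
    finally show ?thesis using z by (simp add: power2_eq_square)
  qed
  have q: "0 < q" "q < 1 / 4"
  proof -
    show "0 < q" using s \<open>z\<^sup>2 < 1\<close> by (simp add: q_def s4 add_pos_nonneg)
    have "z * (1 - z) < 93 / 100 * (12 / 100)" using z by (intro mult_strict_mono) auto
    then have "q\<^sup>2 < (1 / 4)\<^sup>2" unfolding q2 using z by (simp add: divide_less_eq power2_eq_square)
    then show "q < 1 / 4" by (rule power_less_imp_less_base) simp
  qed
  have c: "0 < c" "c < 1 / 2"
  proof -
    show "0 < c" using z by (simp add: c_def)
    have "88 / 100 * 1 < z * (1 + z)" using z by (intro mult_strict_mono) auto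
    then show "c < 1 / 2" using z by (simp add: c_def divide_less_eq)
  qed
  have nz0: "z \<noteq> 0" "1 + z \<noteq> 0" using z by auto
  \<comment> \<open>1 + c and 1 - p share the numerator 1 + z^2, which reduces \<open>rel\<close> to
    a cancellation.\<close>
  have c1: "1 + c = (1 + z\<^sup>2) / (z * (1 + z))" 
    using z nz0 by (simp add: c_def divide_simps) (simp add: algebra_simps power2_eq_square)
  have p1: "1 - q\<^sup>2 = (1 + z\<^sup>2) / (1 + z)" 
    unfolding q2 using z nz0 by (simp add: field_simps power2_eq_square)
  have rel: "(1 + c)\<^sup>2 * q\<^sup>2 = c * (1 - q\<^sup>2)\<^sup>2"
  proof -
    have "(u / (z * w))\<^sup>2 * (z * m / w) = m / (z * w) * (u / w)\<^sup>2" if "w \<noteq> 0" for u w m :: real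
      using that nz0(1) by (simp add: field_simps power2_eq_square)
    then show ?thesis unfolding c1 p1 unfolding q2 c_def using nz0(2) .
  qed
  define t where "t = q / (1 + q\<^sup>2)"
  have nz: "1 + 2 * z - z\<^sup>2 > 0" using \<open>z\<^sup>2 < 1\<close> z by simp
  have pq: "1 + q\<^sup>2 = (1 + 2 * z - z\<^sup>2) / (1 + z)" 
    unfolding q2 using z nz0 by (simp add: field_simps power2_eq_square)
  have t_alt: "t = s * sqrt (1 - s ^ 4) / (1 + 2 * s\<^sup>2 - s ^ 4)"
    unfolding t_def pq unfolding q_def s4 z_def[symmetric] using nz0 by simp
  have "csqrt (of_real (1 - s ^ 4)) = of_real (sqrt (1 - s ^ 4))"
    using \<open>z\<^sup>2 < 1\<close> by (subst of_real_sqrt) (auto simp: s4)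
  then have tp: "tpar (of_real s) = of_real t"
    by (simp add: tpar_def t_alt)
  have "t \<le> q" unfolding t_def using q by (intro divide_le_self) auto
  moreover have "0 < t" using q by (simp add: t_def add_pos_nonneg)
  ultimately have t13: "0 < t" "t < 1 / 3" using q by auto
  then show "norm (tpar (of_real s)) < 1 / 3" by (simp add: tp)
  have no: "nome (of_real s) = of_real (q\<^sup>2)" by (simp add: nome_def q2 z_def)
  have sh: "shift (of_real s) = of_real (c * q\<^sup>2)"
  proof -
    have "c * q\<^sup>2 = ((1 - z) / (1 + z))\<^sup>2" unfolding c_def q2 using nz0 by (simp add: power2_eq_square)
    then show ?thesis by (simp add: shift_def z_def)
  qed
  let ?l = "\<lambda>k. (-1) ^ k * (c * q\<^sup>2 * (q\<^sup>2) ^ k / (1 + c * q\<^sup>2 * (q\<^sup>2) ^ k))"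
  have lt: "lambert_term k (of_real s) = of_real (?l k)" for k
    by (simp add: lambert_term_def no sh)
  have sl: "summable ?l"
  proof (rule summable_comparison_test')
    show "summable (\<lambda>k. c * q\<^sup>2 * (q\<^sup>2) ^ k)"
      using q by (intro summable_mult summable_geometric) (auto simp: power_less_one_iff abs_less_iff)
    fix k
    have den: "1 + c * q\<^sup>2 * (q\<^sup>2) ^ k \<ge> 1" using c by simp
    have "norm (?l k) = c * q\<^sup>2 * (q\<^sup>2) ^ k / (1 + c * q\<^sup>2 * (q\<^sup>2) ^ k)"
      unfolding norm_mult norm_divide using c den by (simp add: power_abs)
    also have "\<dots> \<le> c * q\<^sup>2 * (q\<^sup>2) ^ k"
      by (rule divide_le_self[OF _ den]) (use c in auto)
    finally show "norm (?l k) \<le> c * q\<^sup>2 * (q\<^sup>2) ^ k" by simp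
  qed
  have sum: "(\<Sum>k. lambert_term k (of_real s)) = of_real (\<Sum>k. ?l k)"
    unfolding lt by (rule suminf_of_real[OF sl, symmetric])
  have "(1 + s ^ 4) / (t * (1 + 2 * s\<^sup>2 - s ^ 4)) = (1 - q\<^sup>2) / q"
    unfolding t_def p1 pq s4 z_def[symmetric] using nz0 nz q by simp
  then have f1: "(1 + of_real s ^ 4) / (of_real t * (1 + 2 * (of_real s)\<^sup>2 - of_real s ^ 4)) =
      (of_real ((1 - q\<^sup>2) / q) :: complex)"
    unfolding of_real_eq_iff[symmetric, where ?'a = complex] by simp
  have "(1 - s\<^sup>2) / (1 + s ^ 4) = c / (1 + c)"
    unfolding c1 s4 z_def[symmetric] using nz0
    by (simp add: c_def)
  then have f2: "(1 - (of_real s)\<^sup>2) / (1 + of_real s ^ 4) = (of_real (c / (1 + c)) :: complex)"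
    unfolding of_real_eq_iff[symmetric, where ?'a = complex] by simp
  have "counting_cont (of_real s) =
     of_real ((1 - 2 * ((1 - q\<^sup>2) / q * (c / (1 + c) - 2 * (\<Sum>k. ?l k)))) / (1 - 3 * t))"
    unfolding counting_cont_def tp sum f1 f2 by simp
  also have "(1 - 2 * ((1 - q\<^sup>2) / q * (c / (1 + c) - 2 * (\<Sum>k. ?l k)))) / (1 - 3 * t)
      = (\<Sum>n. of_nat (card (quarter_walks three_steps n)) * t ^ n)"
    unfolding counting_series_uniformised[OF rel c q, folded t_def, symmetric] using t13 by simp
  also have "of_real \<dots> = (\<Sum>n. of_real (of_nat (card (quarter_walks three_steps n)) * t ^ n) :: complex)"
    by (rule suminf_of_real)
       (use summable_walk_sum[of 1 1 t] t13 in \<open>simp add: walk_sum_1_1\<close>)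
  also have "\<dots> = eval_fps (quarter_counting_gf three_steps) (tpar (of_real s))"
    by (simp add: eval_fps_def quarter_counting_gf_nth tp)
  finally show "eval_fps (quarter_counting_gf three_steps) (tpar (of_real s)) = counting_cont (of_real s)" ..
qed

section \<open>Meromorphic continuation\<close>

lemma one_plus_eq_0_iff: "1 + w = 0 \<longleftrightarrow> w = (-1 :: 'a::ring_1)"
  by (simp add: eq_neg_iff_add_eq_0 add.commute)

text \<open>All powers s^k with k > 0 stay in the unit disc, so 1 - s^4 has positive real part and
  the square root in \<open>tpar\<close> never meets its branch cut.\<close>

lemma unit_disc_nonzero:
  fixes s :: complex
  assumes "norm s < 1"
  shows "1 + s\<^sup>2 \<noteq> 0" "1 - s\<^sup>2 \<noteq> 0" "1 + s ^ 4 \<noteq> 0" "1 - s ^ 4 \<noteq> 0" "1 - s ^ 4 \<notin> \<real>\<^sub>\<le>\<^sub>0"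
proof -
  have n: "norm (s ^ k) < 1" if "k > 0" for k
    using assms that by (simp add: norm_power power_less_one_iff)
  have a: "1 + w \<noteq> 0 \<and> 1 - w \<noteq> 0" if "norm w < 1" for w :: complex
  proof (intro conjI notI)
    assume "1 + w = 0"
    then have "w = -1" by (simp only: one_plus_eq_0_iff)
    then show False using that by simp
  next
    assume "1 - w = 0"
    then show False using that by simp
  qed
  show "1 + s\<^sup>2 \<noteq> 0" "1 - s\<^sup>2 \<noteq> 0" "1 + s ^ 4 \<noteq> 0" "1 - s ^ 4 \<noteq> 0"
    using a[OF n] by auto
  have "Re (s ^ 4) < 1" using complex_Re_le_cmod[of "s ^ 4"] n[of 4] by linarith
  then show "1 - s ^ 4 \<notin> \<real>\<^sub>\<le>\<^sub>0" by (auto simp: complex_nonpos_Reals_iff)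
qed

definition param_domain :: "complex set" where
  "param_domain = {s. norm s < 1 \<and> norm (nome s) < 1}"

text \<open>A region where the Lambert terms with index at least \<open>K\<close> are free of poles
  and have a geometric majorant. The condition on \<open>shift\<close> is needed because v is
  unbounded near s = \<i> and s = -\<i>.\<close>

definition cont_domain :: "real \<Rightarrow> nat \<Rightarrow> complex set" where
  "cont_domain \<rho> K = {s. norm s < 1 \<and> norm (nome s) < \<rho> \<and> norm (shift s) * \<rho> ^ K < 1 / 2}"

text \<open>The denominator is (1 + s^2)(1 + p), and |p| < 1 excludes p = -1.\<close>

lemma tpar_denominator_nonzero:
  assumes "norm s < 1" "norm (nome s) < 1"
  shows "1 + 2 * s\<^sup>2 - s ^ 4 \<noteq> 0"
proof
  assume *: "1 + 2 * s\<^sup>2 - s ^ 4 = 0"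
  have "1 + nome s = (1 + 2 * s\<^sup>2 - s ^ 4) / (1 + s\<^sup>2)"
    using unit_disc_nonzero[OF assms(1)] by (simp add: nome_def field_simps flip: power_add)
  then have "1 + nome s = 0" using * by simp
  then have "nome s = -1" by (simp only: one_plus_eq_0_iff)
  then show False using assms by simp
qed

lemma holomorphic_on_nome: "nome holomorphic_on ball 0 1"
  and holomorphic_on_shift: "shift holomorphic_on ball 0 1"
  unfolding nome_def shift_def using unit_disc_nonzero by (auto intro!: holomorphic_intros)

lemma open_cont_domain: "open (cont_domain \<rho> K)"
proof -
  have "open (ball 0 1 \<inter> nome -` ball 0 \<rho>)"
    by (intro continuous_open_preimage holomorphic_on_imp_continuous_on holomorphic_on_nome) auto
  moreover have "open (ball 0 1 \<inter> (\<lambda>s. norm (shift s) * \<rho> ^ K) -` {..<1 / 2})"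
    by (intro continuous_open_preimage continuous_intros holomorphic_on_imp_continuous_on
        holomorphic_on_shift) auto
  moreover have "cont_domain \<rho> K = (ball 0 1 \<inter> nome -` ball 0 \<rho>) \<inter>
      (ball 0 1 \<inter> (\<lambda>s. norm (shift s) * \<rho> ^ K) -` {..<1 / 2})"
    by (auto simp: cont_domain_def)
  ultimately show ?thesis by auto
qed

lemma open_param_domain: "open param_domain"
proof -
  have "open (ball 0 1 \<inter> nome -` ball 0 1)"
    by (intro continuous_open_preimage holomorphic_on_imp_continuous_on holomorphic_on_nome) auto
  moreover have "param_domain = ball 0 1 \<inter> nome -` ball 0 1"
    by (auto simp: param_domain_def)
  ultimately show ?thesis by simp
qed

lemma cont_domain_subset_param_domain: "\<rho> \<le> 1 \<Longrightarrow> cont_domain \<rho> K \<subseteq> param_domain"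
  by (auto simp: cont_domain_def param_domain_def)

lemma holomorphic_on_tpar: "tpar holomorphic_on param_domain"
  unfolding tpar_def using unit_disc_nonzero tpar_denominator_nonzero
  by (auto intro!: holomorphic_intros simp: param_domain_def)

text \<open>Each w = v p^(k+K) satisfies |w| <= \<rho>^k / 2, hence |1 + w| >= 1/2, and the quotient
  is at most \<rho>^k.\<close>

lemma lambert_tail_bound:
  assumes "s \<in> cont_domain \<rho> K" "0 < \<rho>" "\<rho> < 1"
  shows "norm (shift s * nome s ^ (k + K)) < 1 / 2" "norm (lambert_term (k + K) s) \<le> \<rho> ^ k"
proof -
  have "norm (shift s * nome s ^ (k + K)) \<le> norm (shift s) * \<rho> ^ (k + K)"
    unfolding norm_mult norm_power using assms
    by (intro mult_left_mono power_mono) (auto simp: cont_domain_def)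
  also have "\<dots> = (norm (shift s) * \<rho> ^ K) * \<rho> ^ k" by (simp add: power_add)
  also have "\<dots> \<le> 1 / 2 * \<rho> ^ k"
    using assms by (intro mult_right_mono) (auto simp: cont_domain_def)
  finally have 1: "norm (shift s * nome s ^ (k + K)) \<le> \<rho> ^ k / 2" by simp
  have 2: "norm (shift s * nome s ^ (k + K)) < 1 / 2"
  proof (cases "k = 0")
    case True
    have "norm (shift s * nome s ^ (k + K)) \<le> norm (shift s) * \<rho> ^ K"
      unfolding norm_mult norm_power using assms True
      by (auto simp: cont_domain_def intro!: mult_left_mono power_mono)
    then show ?thesis using assms by (auto simp: cont_domain_def)
  next
    case False
    then have "\<rho> ^ k < 1" using assms by (simp add: power_less_one_iff)
    then show ?thesis using 1 by linarith
  qed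
  then show "norm (shift s * nome s ^ (k + K)) < 1 / 2" .
  define w where "w = shift s * nome s ^ (k + K)"
  have "1 - norm w \<le> norm (1 + w)" by (metis add.commute norm_one norm_diff_ineq)
  then have "norm (1 + w) \<ge> 1 / 2" using 2 unfolding w_def by linarith
  have "norm (lambert_term (k + K) s) = norm w / norm (1 + w)"
    by (simp add: lambert_term_def norm_mult norm_divide norm_power w_def)
  also have "\<dots> \<le> (\<rho> ^ k / 2) / (1 / 2)"
    using 1 \<open>norm (1 + w) \<ge> 1 / 2\<close> assms by (intro frac_le) (auto simp: w_def)
  finally show "norm (lambert_term (k + K) s) \<le> \<rho> ^ k" by simp
qed

lemma lambert_term_holomorphic:
  assumes "A \<subseteq> ball 0 1" "\<And>s. s \<in> A \<Longrightarrow> 1 + shift s * nome s ^ k \<noteq> 0"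
  shows "lambert_term k holomorphic_on A"
  unfolding lambert_term_def
  using holomorphic_on_subset[OF holomorphic_on_nome assms(1)]
    holomorphic_on_subset[OF holomorphic_on_shift assms(1)] assms(2)
  by (intro holomorphic_intros) auto

text \<open>Uniform convergence by the majorant \<rho>^k makes the tail holomorphic; poles can come
  only from the first \<open>K\<close> terms.\<close>

lemma lambert_tail:
  assumes \<rho>: "0 < \<rho>" "\<rho> < 1"
  shows "(\<lambda>s. \<Sum>k. lambert_term (k + K) s) holomorphic_on cont_domain \<rho> K"
    "\<And>s. s \<in> cont_domain \<rho> K \<Longrightarrow>
      (\<Sum>k. lambert_term k s) = (\<Sum>k. lambert_term (k + K) s) + (\<Sum>k<K. lambert_term k s)"
proof -
  note tb = lambert_tail_bound[OF _ \<rho>]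
  have sm: "summable (\<lambda>k. \<rho> ^ k)" using \<rho> by (intro summable_geometric) auto
  have ul: "uniform_limit (cont_domain \<rho> K) (\<lambda>n s. \<Sum>k<n. lambert_term (k + K) s)
      (\<lambda>s. \<Sum>k. lambert_term (k + K) s) sequentially"
    by (rule Weierstrass_m_test[OF tb(2) sm])
  have nz: "1 + shift s * nome s ^ (k + K) \<noteq> 0" if "s \<in> cont_domain \<rho> K" for s k
  proof
    assume "1 + shift s * nome s ^ (k + K) = 0"
    then have "shift s * nome s ^ (k + K) = -1" by (simp only: one_plus_eq_0_iff)
    then show False using tb(1)[OF that, of k] by simp
  qed
  show "(\<lambda>s. \<Sum>k. lambert_term (k + K) s) holomorphic_on cont_domain \<rho> K"
  proof (rule holomorphic_uniform_sequence[OF open_cont_domain])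
    show "(\<lambda>s. \<Sum>k<n. lambert_term (k + K) s) holomorphic_on cont_domain \<rho> K" for n
      by (intro holomorphic_intros lambert_term_holomorphic nz) (auto simp: cont_domain_def)
    show "\<exists>d>0. cball x d \<subseteq> cont_domain \<rho> K \<and>
        uniform_limit (cball x d) (\<lambda>n s. \<Sum>k<n. lambert_term (k + K) s)
          (\<lambda>s. \<Sum>k. lambert_term (k + K) s) sequentially" if "x \<in> cont_domain \<rho> K" for x
      using open_cont_domain[of \<rho> K] that uniform_limit_on_subset[OF ul]
      unfolding open_contains_cball by meson
  qed
  fix s assume s: "s \<in> cont_domain \<rho> K"
  have "summable (\<lambda>k. lambert_term (k + K) s)"
    by (rule summable_comparison_test'[OF sm tb(2)[OF s]])
  then have "summable (\<lambda>k. lambert_term k s)" by (rule summable_iff_shift[THEN iffD1])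
  then show "(\<Sum>k. lambert_term k s) = (\<Sum>k. lambert_term (k + K) s) + (\<Sum>k<K. lambert_term k s)"
    by (rule suminf_split_initial_segment)
qed

section \<open>Finiteness of the exceptional sets\<close>

lemma finite_zeros_of_polynomial_fun:
  fixes f :: "complex \<Rightarrow> complex"
  assumes "\<And>s. f s = poly P s" "f x \<noteq> 0"
  shows "finite {s. f s = 0}"
proof -
  have "P \<noteq> 0" using assms by auto
  then show ?thesis using poly_roots_finite[of P] by (simp add: assms(1))
qed

lemma tpar_sq: "(tpar s)\<^sup>2 = s\<^sup>2 * (1 - s ^ 4) / (1 + 2 * s\<^sup>2 - s ^ 4)\<^sup>2"
  by (simp add: tpar_def power_mult_distrib power_divide)

text \<open>Squaring removes the square root, so the points of a fibre are zeros of a polynomial in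
  s.\<close>

lemma finite_tpar_fibre: "finite {s \<in> param_domain. tpar s = r}"
proof (rule finite_subset)
  let ?f = "\<lambda>s :: complex. s\<^sup>2 * (1 - s ^ 4) - r\<^sup>2 * (1 + 2 * s\<^sup>2 - s ^ 4)\<^sup>2"
  show "{s \<in> param_domain. tpar s = r} \<subseteq> {s. ?f s = 0}"
  proof
    fix s assume "s \<in> {s \<in> param_domain. tpar s = r}"
    then have s: "s \<in> param_domain" "tpar s = r" by auto
    then have "1 + 2 * s\<^sup>2 - s ^ 4 \<noteq> 0" "norm s < 1"
      using tpar_denominator_nonzero[of s] by (auto simp: param_domain_def)
    then show "s \<in> {s. ?f s = 0}" using tpar_sq[of s] s(2) by simp
  qed
  define X where "X = [:0, 1 :: complex:]"
  have X: "?f s = poly (X\<^sup>2 * (1 - X ^ 4) - [:r\<^sup>2:] * (1 + 2 * X\<^sup>2 - X ^ 4)\<^sup>2) s" for s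
    by (simp add: X_def)
  \<comment> \<open>The value -r^2 at 0 settles nonzero r; for r = 0 the value at 2 is -60.\<close>
  have "?f 0 \<noteq> 0 \<or> ?f 2 \<noteq> 0" by auto
  then show "finite {s. ?f s = 0}" using finite_zeros_of_polynomial_fun[OF X] by blast
qed

text \<open>Where t' vanishes, so does the derivative of t^2, which is a rational function of
  s.\<close>

lemma finite_tpar_critical: "finite {s \<in> param_domain. deriv tpar s = 0}"
proof (rule finite_subset)
  let ?f = "\<lambda>s :: complex. (2 * s - 6 * s ^ 5) * (1 + 2 * s\<^sup>2 - s ^ 4) - (s\<^sup>2 - s ^ 6) * (2 * (4 * s - 4 * s ^ 3))"
  show "{s \<in> param_domain. deriv tpar s = 0} \<subseteq> {s. ?f s = 0}"
  proof clarify
    fix s assume s: "s \<in> param_domain" "deriv tpar s = 0"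
    define d where "d = 1 + 2 * s\<^sup>2 - s ^ 4"
    have nz: "d \<noteq> 0" "norm s < 1"
      using tpar_denominator_nonzero[of s] s by (auto simp: param_domain_def d_def)
    have "(tpar has_field_derivative deriv tpar s) (at s)"
      by (rule holomorphic_derivI[OF holomorphic_on_tpar open_param_domain]) (use s in auto)
    then have "((\<lambda>s. (tpar s)\<^sup>2) has_field_derivative 0) (at s)"
      using s(2) by (auto intro!: derivative_eq_intros)
    moreover have ev: "\<forall>\<^sub>F s in nhds s. (tpar s)\<^sup>2 = (s\<^sup>2 - s ^ 6) / (1 + 2 * s\<^sup>2 - s ^ 4)\<^sup>2"
      unfolding eventually_nhds
      by (rule exI[of _ "param_domain"])
         (use s open_param_domain in \<open>auto simp: tpar_sq param_domain_def algebra_simps simp flip: power_add\<close>)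
    ultimately have "((\<lambda>s. (s\<^sup>2 - s ^ 6) / (1 + 2 * s\<^sup>2 - s ^ 4)\<^sup>2) has_field_derivative 0) (at s)"
      using DERIV_cong_ev[OF refl ev refl] by blast
    moreover have "((\<lambda>s. (s\<^sup>2 - s ^ 6) / (1 + 2 * s\<^sup>2 - s ^ 4)\<^sup>2) has_field_derivative
        ((2 * s - 6 * s ^ 5) * d\<^sup>2 - (s\<^sup>2 - s ^ 6) * (2 * d * (4 * s - 4 * s ^ 3))) / (d\<^sup>2 * d\<^sup>2)) (at s)"
      unfolding d_def using nz(1)[unfolded d_def] by (auto intro!: derivative_eq_intros)
    ultimately have "((2 * s - 6 * s ^ 5) * d\<^sup>2 - (s\<^sup>2 - s ^ 6) * (2 * d * (4 * s - 4 * s ^ 3))) / (d\<^sup>2 * d\<^sup>2) = 0"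
      by (rule DERIV_unique[symmetric])
    then have "(2 * s - 6 * s ^ 5) * d\<^sup>2 - (s\<^sup>2 - s ^ 6) * (2 * d * (4 * s - 4 * s ^ 3)) = 0" using nz by simp
    then have "d * ((2 * s - 6 * s ^ 5) * d - (s\<^sup>2 - s ^ 6) * (2 * (4 * s - 4 * s ^ 3))) = 0"
      by (simp add: power2_eq_square algebra_simps)
    then show "?f s = 0" using nz(1) by (simp only: mult_eq_0_iff d_def) simp
  qed
  define X where "X = [:0, 1 :: complex:]"
  have X: "?f s = poly ((2 * X - 6 * X ^ 5) * (1 + 2 * X\<^sup>2 - X ^ 4) - (X\<^sup>2 - X ^ 6) * (2 * (4 * X - 4 * X ^ 3))) s" for s
    by (simp add: X_def mult.commute)
  have "?f 1 \<noteq> 0" by simp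
  then show "finite {s. ?f s = 0}" using finite_zeros_of_polynomial_fun[OF X] by blast
qed

text \<open>Multiplied by (1 + s^2)^(k+2) the condition becomes polynomial in s, and that polynomial
  has the value 2^(k+2) at s = 1.\<close>

lemma finite_lambert_poles: "finite {s. norm s < 1 \<and> 1 + shift s * nome s ^ k = 0}"
proof (rule finite_subset)
  let ?f = "\<lambda>s :: complex. (1 + s\<^sup>2) ^ (2 + k) + (1 - s\<^sup>2)\<^sup>2 * (s\<^sup>2 * (1 - s\<^sup>2)) ^ k"
  show "{s. norm s < 1 \<and> 1 + shift s * nome s ^ k = 0} \<subseteq> {s. ?f s = 0}"
  proof clarify
    fix s :: complex assume s: "norm s < 1" "1 + shift s * nome s ^ k = 0"
    have "?f s = (1 + s\<^sup>2) ^ (2 + k) * (1 + shift s * nome s ^ k)"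
    proof -
      have "w ^ (2 + k) + a\<^sup>2 * b ^ k = w ^ (2 + k) * (1 + (a / w)\<^sup>2 * (b / w) ^ k)" if "w \<noteq> 0" for w a b :: complex
        using that by (simp add: power_divide distrib_left power2_eq_square)
      then show ?thesis unfolding shift_def nome_def using unit_disc_nonzero(1)[OF s(1)] .
    qed
    then show "?f s = 0" using s(2) by simp
  qed
  define X where "X = [:0, 1 :: complex:]"
  have X: "?f s = poly ((1 + X\<^sup>2) ^ (2 + k) + (1 - X\<^sup>2)\<^sup>2 * (X\<^sup>2 * (1 - X\<^sup>2)) ^ k) s" for s
    by (simp add: X_def)
  have "?f 1 \<noteq> 0" by simp
  then show "finite {s. ?f s = 0}" using finite_zeros_of_polynomial_fun[OF X] by blast
qed

section \<open>Poles on the imaginary axis and the path leading to them\<close>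

lemma nome_shift_imaginary:
  "nome (\<i> * of_real y) = - of_real (y\<^sup>2 * (1 + y\<^sup>2) / (1 - y\<^sup>2))"
    "shift (\<i> * of_real y) = of_real (((1 + y\<^sup>2) / (1 - y\<^sup>2))\<^sup>2)"
  by (simp_all add: nome_def shift_def power_mult_distrib)

text \<open>The poles lie at \<open>s = \<i> y\<close> and accumulate at \<open>y\<^sup>2 = sqrt 2 - 1\<close>, where \<open>nome s = -1\<close>.\<close>

lemma infinite_lambert_poles:
  "infinite {s. \<exists>y k. s = \<i> * of_real y \<and> 0 < y \<and> y < 1 \<and> norm (nome s) < 1 \<and> 1 + shift s * nome s ^ k = 0}"
proof -
  \<comment> \<open>The positive root of u (1 + u) = 1 - u, where u stands for y^2. On the imaginary
    axis \<open>A\<close> is -p and \<open>V\<close> is v, so \<open>b\<close> is the point with p =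
    -1.\<close>
  define b :: real where "b = sqrt 2 - 1"
  have b2: "b * (1 + b) = 1 - b" by (simp add: b_def algebra_simps)
  have "1 < sqrt 2" "sqrt 2 < 2" using real_less_rsqrt[of 1 2] real_less_lsqrt[of 2 2] by auto
  then have b: "0 < b" "b < 1" by (auto simp: b_def)
  define A where "A u = u * (1 + u) / (1 - u)" for u :: real
  define V where "V u = ((1 + u) / (1 - u))\<^sup>2" for u :: real
  \<comment> \<open>Since p = -A(u) is negative, an odd exponent turns v p^k = -1 into V(u) A(u)^k =
    1. The left side is continuous, 0 at u = 0 and V(b) > 1 at u = b.\<close>
  have "\<exists>u. 0 < u \<and> u < b \<and> V u * A u ^ (2 * j + 1) = 1" for j :: nat
  proof -
    define h where "h u = V u * A u ^ (2 * j + 1)" for u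
    have "A b = 1" using b b2 by (simp add: A_def)
    moreover have "1 < V b" using b by (simp add: V_def less_divide_eq)
    ultimately have hb: "1 < h b" by (simp add: h_def)
    have h0: "h 0 = 0" by (simp add: h_def A_def)
    have "continuous_on {0..b} h"
      unfolding h_def V_def A_def using b by (intro continuous_intros) auto
    then obtain u where "0 \<le> u" "u \<le> b" "h u = 1"
      using IVT'[of h 0 1 b] hb h0 b by auto
    moreover have "u \<noteq> 0" "u \<noteq> b" using calculation h0 hb by auto
    ultimately show ?thesis by (intro exI[of _ u]) (auto simp: h_def)
  qed
  then obtain u where u: "\<And>j. 0 < u j" "\<And>j. u j < b" "\<And>j. V (u j) * A (u j) ^ (2 * j + 1) = 1"
    by metis
  have A01: "0 < A (u j) \<and> A (u j) < 1" for j
  proof -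
    have "u j * (1 + u j) < b * (1 + b)" using u(1,2)[of j] b by (intro mult_strict_mono) auto
    then have "u j * (1 + u j) < 1 - u j" using b2 u(2)[of j] by linarith
    then show ?thesis using u(1,2)[of j] b by (simp add: A_def divide_less_eq)
  qed
  \<comment> \<open>A common value would give equal powers of a number in (0, 1) with different
    exponents.\<close>
  have inj: "inj u"
  proof (rule injI)
    fix i j assume ij: "u i = u j"
    have "V (u j) \<noteq> 0" using u(3)[of j] by auto
    then have "A (u j) ^ (2 * i + 1) = A (u j) ^ (2 * j + 1)"
      using u(3)[of i] u(3)[of j] unfolding ij by (metis mult_left_cancel)
    then show "i = j"
      using power_strict_decreasing[of "2 * i + 1" "2 * j + 1" "A (u j)"]
        power_strict_decreasing[of "2 * j + 1" "2 * i + 1" "A (u j)"] A01[of j]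
      by (cases i j rule: linorder_cases) auto
  qed
  define s where "s j = \<i> * complex_of_real (sqrt (u j))" for j
  have "inj s" using inj u(1) by (auto simp: inj_def s_def)
  then have "infinite (range s)" by (rule range_inj_infinite)
  moreover have "range s \<subseteq> {s. \<exists>y k. s = \<i> * of_real y \<and> 0 < y \<and> y < 1 \<and> norm (nome s) < 1 \<and> 1 + shift s * nome s ^ k = 0}"
  proof clarify
    fix j
    have sq: "(sqrt (u j))\<^sup>2 = u j" using u(1)[of j] by simp
    have ns: "nome (s j) = - of_real (A (u j))" "shift (s j) = of_real (V (u j))"
      using nome_shift_imaginary[of "sqrt (u j)"] u(1)[of j] unfolding s_def sq A_def V_def by auto
    have "shift (s j) * nome (s j) ^ (2 * j + 1) = - of_real (V (u j) * A (u j) ^ (2 * j + 1))"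
      unfolding ns by (simp add: power_minus_odd)
    then have "1 + shift (s j) * nome (s j) ^ (2 * j + 1) = 0" by (simp only: u(3)) simp
    then show "\<exists>y k. s j = \<i> * of_real y \<and> 0 < y \<and> y < 1 \<and> norm (nome (s j)) < 1 \<and> 1 + shift (s j) * nome (s j) ^ k = 0"
      using u(1,2)[of j] b A01[of j]
      by (intro exI[of _ "sqrt (u j)"] exI[of _ "2 * j + 1"]) (auto simp: ns, auto simp: s_def)
  qed
  ultimately show ?thesis using finite_subset by blast
qed

text \<open>For real s in [0, 1) one has 0 <= p <= 1/4 and 0 <= v <= 1, so the conditions on \<rho>
  and \<open>K\<close> need not depend on the point.\<close>

lemma real_segment_in_cont_domain:
  assumes "0 \<le> x" "x < 1" "1 / 2 \<le> \<rho>" "\<rho> ^ K < 1 / 2"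
  shows "of_real x \<in> cont_domain \<rho> K"
proof -
  define z where "z = x\<^sup>2"
  have z: "0 \<le> z" "z < 1" using assms by (auto simp: z_def power_less_one_iff)
  have n: "nome (of_real x) = of_real (z * (1 - z) / (1 + z))"
    and v: "shift (of_real x) = of_real (((1 - z) / (1 + z))\<^sup>2)"
    by (simp_all add: nome_def shift_def z_def)
  have "z * (1 - z) \<le> 1 / 4" using zero_le_power2[of "z - 1 / 2"]
    by (simp add: power2_eq_square algebra_simps)
  moreover have "z * (1 - z) / (1 + z) \<le> z * (1 - z)" using z by (intro divide_le_self) auto
  moreover have "0 \<le> z * (1 - z) / (1 + z)" using z by simp
  ultimately have "norm (nome (of_real x)) < \<rho>" unfolding n norm_of_real using assms by linarith
  moreover have "((1 - z) / (1 + z))\<^sup>2 \<le> 1"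
    using z by (intro power_le_one) (auto simp: divide_le_eq)
  then have "norm (shift (of_real x)) * \<rho> ^ K \<le> 1 * \<rho> ^ K"
    unfolding v norm_of_real using assms by (intro mult_right_mono) auto
  then have "norm (shift (of_real x)) * \<rho> ^ K < 1 / 2" using assms(4) by linarith
  ultimately show ?thesis using assms by (auto simp: cont_domain_def)
qed

text \<open>Both |p| and |v| increase with y along the imaginary axis, so the endpoint controls the
  whole segment.\<close>

lemma imaginary_segment_in_cont_domain:
  assumes y: "0 \<le> y" "y \<le> y0" "y0\<^sup>2 < 1" "0 \<le> \<rho>"
    and \<rho>: "norm (nome (\<i> * of_real y0)) < \<rho>" "norm (shift (\<i> * of_real y0)) * \<rho> ^ K < 1 / 2"
  shows "\<i> * of_real y \<in> cont_domain \<rho> K"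
proof -
  define u u0 where "u = y\<^sup>2" and "u0 = y0\<^sup>2"
  have u: "0 \<le> u" "u \<le> u0" "u0 < 1" using y by (auto simp: u_def u0_def intro: power_mono)
  have "u * (1 + u) / (1 - u) \<le> u0 * (1 + u0) / (1 - u0)"
    using u by (intro frac_le mult_mono) auto
  moreover have "norm (nome (\<i> * of_real y)) = u * (1 + u) / (1 - u)"
    using u y(1) unfolding nome_shift_imaginary norm_minus_cancel norm_of_real
    by (fold u_def) (auto intro!: abs_of_nonneg divide_nonneg_pos mult_nonneg_nonneg)
  moreover have "norm (nome (\<i> * of_real y0)) = u0 * (1 + u0) / (1 - u0)"
    using u y unfolding nome_shift_imaginary norm_minus_cancel norm_of_real
    by (fold u0_def) (auto intro!: abs_of_nonneg divide_nonneg_pos mult_nonneg_nonneg)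
  ultimately have 1: "norm (nome (\<i> * of_real y)) < \<rho>" using \<rho>(1) by linarith
  have "((1 + u) / (1 - u))\<^sup>2 \<le> ((1 + u0) / (1 - u0))\<^sup>2"
    using u by (intro power_mono frac_le) auto
  then have "norm (shift (\<i> * of_real y)) \<le> norm (shift (\<i> * of_real y0))"
    unfolding nome_shift_imaginary norm_of_real
    by (fold u_def u0_def) simp
  then have "norm (shift (\<i> * of_real y)) * \<rho> ^ K \<le> norm (shift (\<i> * of_real y0)) * \<rho> ^ K"
    using y by (intro mult_right_mono) auto
  then have 2: "norm (shift (\<i> * of_real y)) * \<rho> ^ K < 1 / 2" using \<rho>(2) by linarith
  have "y\<^sup>2 < 1" using u by (simp add: u_def)
  then have "norm (\<i> * complex_of_real y) < 1" using y(1) by (simp add: norm_mult power_less_one_iff abs_square_less_1)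
  then show ?thesis using 1 2 by (simp add: cont_domain_def)
qed

section \<open>From the formal to the analytic differential equation\<close>

lemma higher_deriv_eval_fps:
  fixes f :: "complex fps"
  assumes "norm z < r" "ereal r \<le> fps_conv_radius f"
  shows "(deriv ^^ k) (eval_fps f) z = eval_fps ((fps_deriv ^^ k) f) z"
    "ereal r \<le> fps_conv_radius ((fps_deriv ^^ k) f)"
proof -
  show R: "ereal r \<le> fps_conv_radius ((fps_deriv ^^ k) f)" for k
    using assms(2) by (induction k) (auto intro: order_trans[OF _ fps_conv_radius_deriv])
  show "(deriv ^^ k) (eval_fps f) z = eval_fps ((fps_deriv ^^ k) f) z"
    using assms(1)
  proof (induction k arbitrary: z)
    case (Suc k)
    have "ereal (norm z) < ereal r" using Suc.prems by simp
    also have "\<dots> \<le> fps_conv_radius ((fps_deriv ^^ k) f)" by (rule R)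
    finally have less: "ereal (norm z) < fps_conv_radius ((fps_deriv ^^ k) f)" .
    have "\<forall>\<^sub>F z in nhds z. (deriv ^^ k) (eval_fps f) z = eval_fps ((fps_deriv ^^ k) f) z"
      unfolding eventually_nhds using Suc by (intro exI[of _ "ball 0 r"]) auto
    then have "deriv ((deriv ^^ k) (eval_fps f)) z = deriv (eval_fps ((fps_deriv ^^ k) f)) z"
      by (rule deriv_cong_ev) simp
    then show ?case using eval_fps_deriv[OF less] by simp
  qed simp
qed

lemma fps_ode_imp_ode:
  fixes f :: "complex fps" and P :: "nat \<Rightarrow> complex poly"
  assumes rel: "(\<Sum>k\<le>N. fps_of_poly (P k) * (fps_deriv ^^ k) f) = 0"
    and z: "norm z < r" "ereal r \<le> fps_conv_radius f"
  shows "(\<Sum>k\<le>N. poly (P k) z * (deriv ^^ k) (eval_fps f) z) = 0"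
proof -
  have less: "ereal (norm z) < fps_conv_radius ((fps_deriv ^^ k) f)" for k
    using z higher_deriv_eval_fps(2)[OF z] less_le_trans by (metis ereal_less_eq(3) ereal_less(2) less_ereal.simps(1))
  have ev: "eval_fps (fps_of_poly (P k) * (fps_deriv ^^ k) f) z = poly (P k) z * (deriv ^^ k) (eval_fps f) z" for k
    by (subst eval_fps_mult) (auto simp: less higher_deriv_eval_fps(1)[OF z])
  have "ereal (norm z) < fps_conv_radius (fps_of_poly (P k) * (fps_deriv ^^ k) f)" for k
    using less[of k] fps_conv_radius_mult[of "fps_of_poly (P k)" "(fps_deriv ^^ k) f"]
    by (simp add: less_le_trans)
  then have "(\<lambda>n. fps_nth (fps_of_poly (P k) * (fps_deriv ^^ k) f) n * z ^ n) sums
      (poly (P k) z * (deriv ^^ k) (eval_fps f) z)" for k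
    using sums_eval_fps unfolding ev[symmetric] by blast
  then have "(\<lambda>n. \<Sum>k\<le>N. fps_nth (fps_of_poly (P k) * (fps_deriv ^^ k) f) n * z ^ n) sums
      (\<Sum>k\<le>N. poly (P k) z * (deriv ^^ k) (eval_fps f) z)"
    by (rule sums_sum)
  moreover have "(\<Sum>k\<le>N. fps_nth (fps_of_poly (P k) * (fps_deriv ^^ k) f) n * z ^ n) = 0" for n
  proof -
    have "(\<Sum>k\<le>N. fps_nth (fps_of_poly (P k) * (fps_deriv ^^ k) f) n * z ^ n) =
        fps_nth (\<Sum>k\<le>N. fps_of_poly (P k) * (fps_deriv ^^ k) f) n * z ^ n"
      by (simp add: fps_sum_nth sum_distrib_right)
    then show ?thesis by (simp add: rel)
  qed
  ultimately have "(\<lambda>_. 0) sums (\<Sum>k\<le>N. poly (P k) z * (deriv ^^ k) (eval_fps f) z)" by simp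
  then show ?thesis by (rule sums_unique2) (rule sums_zero)
qed

section \<open>Non-holonomicity\<close>

lemma tpar_nonzero:
  assumes "s \<in> param_domain" "s \<noteq> 0"
  shows "tpar s \<noteq> 0"
  using assms unit_disc_nonzero(4)[of s] tpar_denominator_nonzero[of s]
  by (auto simp: tpar_def param_domain_def)

definition cont_prefactor :: "complex \<Rightarrow> complex" where
  "cont_prefactor s = (1 + s ^ 4) / (tpar s * (1 + 2 * s\<^sup>2 - s ^ 4))"

lemma holomorphic_on_cont_prefactor:
  assumes "A \<subseteq> param_domain - {0}"
  shows "cont_prefactor holomorphic_on A"
proof -
  have "tpar holomorphic_on A" using holomorphic_on_tpar holomorphic_on_subset assms by blast
  moreover have "tpar s \<noteq> 0" "1 + 2 * s\<^sup>2 - s ^ 4 \<noteq> 0" if "s \<in> A" for s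
    using that assms tpar_nonzero[of s] tpar_denominator_nonzero[of s] by (auto simp: param_domain_def)
  ultimately show ?thesis unfolding cont_prefactor_def by (intro holomorphic_intros) auto
qed

lemma counting_cont_eq:
  assumes "0 < \<rho>" "\<rho> < 1" "s \<in> cont_domain \<rho> K"
  shows "counting_cont s = (1 - 2 * (cont_prefactor s * ((1 - s\<^sup>2) / (1 + s ^ 4)
      - 2 * ((\<Sum>k. lambert_term (k + K) s) + (\<Sum>k<K. lambert_term k s))))) / (1 - 3 * tpar s)"
  unfolding counting_cont_def lambert_tail(2)[OF assms] cont_prefactor_def ..

text \<open>The index set \<open>I\<close> is left open for two uses: all k < K for the continuation
  itself, and all k < K except one for the regular part at a pole. The point 0 is excluded because t
  vanishes there and the prefactor divides by t.\<close>

lemma cont_part_holomorphic: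
  assumes \<rho>: "0 < \<rho>" "\<rho> < 1" and A: "A \<subseteq> cont_domain \<rho> K" "0 \<notin> A"
    and t: "\<And>s. s \<in> A \<Longrightarrow> tpar s \<noteq> 1 / 3"
    and I: "\<And>s k. s \<in> A \<Longrightarrow> k \<in> I \<Longrightarrow> 1 + shift s * nome s ^ k \<noteq> 0"
  shows "(\<lambda>s. (1 - 2 * (cont_prefactor s * ((1 - s\<^sup>2) / (1 + s ^ 4)
      - 2 * ((\<Sum>k. lambert_term (k + K) s) + (\<Sum>k\<in>I. lambert_term k s))))) / (1 - 3 * tpar s))
    holomorphic_on A"
proof -
  have sub: "A \<subseteq> param_domain" "A \<subseteq> ball 0 1"
    using A cont_domain_subset_param_domain[of \<rho> K] \<rho> by (auto simp: param_domain_def)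
  have h: "(\<lambda>s. \<Sum>k. lambert_term (k + K) s) holomorphic_on A" "tpar holomorphic_on A"
    "cont_prefactor holomorphic_on A"
    using holomorphic_on_subset[OF lambert_tail(1)[OF \<rho>] A(1)] A(2) sub(1)
      holomorphic_on_subset[OF holomorphic_on_tpar] by (auto intro!: holomorphic_on_cont_prefactor)
  have lt: "lambert_term k holomorphic_on A" if "k \<in> I" for k
    using lambert_term_holomorphic[OF sub(2), of k] I that by blast
  have nz: "1 + s ^ 4 \<noteq> 0" "1 - 3 * tpar s \<noteq> 0" if "s \<in> A" for s
    using sub(2) that unit_disc_nonzero(3)[of s] t[OF that] by (auto simp: mult.commute)
  show ?thesis by (intro holomorphic_intros h lt nz)
qed

text \<open>Exactly one Lambert term is singular at \<open>s0\<close>, and the prefactor does not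
  vanish there, so nothing cancels. The order \<open>n\<close> is the multiplicity of the zero of 1
  + v p^m.\<close>

lemma counting_cont_pole:
  assumes \<rho>: "0 < \<rho>" "\<rho> < 1" and s0: "s0 \<in> cont_domain \<rho> K" "s0 \<noteq> 0" "tpar s0 \<noteq> 1 / 3"
    and zero: "1 + shift s0 * nome s0 ^ m = 0"
    and Z: "finite Z" "\<And>s. s \<in> cont_domain \<rho> K - Z \<Longrightarrow>
      s \<noteq> 0 \<and> tpar s \<noteq> 1 / 3 \<and> (\<forall>k<K. 1 + shift s * nome s ^ k \<noteq> 0)"
  obtains n r h where "0 < n" "0 < r" "h holomorphic_on ball s0 r" "h s0 \<noteq> 0"
    "\<And>s. s \<in> ball s0 r - {s0} \<Longrightarrow> counting_cont s = h s / (s - s0) ^ n"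
    "ball s0 r \<subseteq> cont_domain \<rho> K - (Z - {s0})"
proof -
  define w where "w k s = shift s * nome s ^ k" for k s
  have wm: "w m s0 = -1" using zero by (simp only: w_def one_plus_eq_0_iff)
  have hw: "w k holomorphic_on ball 0 1" for k
    unfolding w_def by (intro holomorphic_intros holomorphic_on_nome holomorphic_on_shift)
  have mK: "m < K"
  proof (rule ccontr)
    assume "\<not> m < K"
    then have "norm (w m s0) < 1 / 2"
      using lambert_tail_bound(1)[OF s0(1) \<rho>, of "m - K"] by (simp add: w_def)
    then show False by (simp add: wm)
  qed
  \<comment> \<open>Two vanishing denominators would give |v| |p|^k = |v| |p|^m = 1 with 0 < |p| <
    1, forcing k = m.\<close>
  have other: "1 + w k s0 \<noteq> 0" if "k \<noteq> m" for k
  proof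
    assume "1 + w k s0 = 0"
    then have wk: "w k s0 = -1" by (simp only: one_plus_eq_0_iff)
    define a where "a = norm (nome s0)"
    have sh: "norm (shift s0) * a ^ k = 1" "norm (shift s0) * a ^ m = 1"
      using arg_cong[OF wk, of norm] arg_cong[OF wm, of norm]
      by (simp_all add: w_def norm_mult norm_power a_def)
    have "a < 1" using s0(1) \<rho> by (auto simp: cont_domain_def a_def)
    have "a \<noteq> 0" using sh \<open>k \<noteq> m\<close> by (cases "k = 0"; cases "m = 0") (auto simp: zero_power)
    then have "0 < a" by (simp add: a_def)
    moreover have "a ^ k = a ^ m" using sh by (metis mult_left_cancel mult_zero_left zero_neq_one)
    ultimately show False
      using \<open>k \<noteq> m\<close> \<open>a < 1\<close> power_strict_decreasing[of k m a] power_strict_decreasing[of m k a]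
      by (cases k m rule: linorder_cases) auto
  qed
  obtain g r1 n where g: "0 < n" "0 < r1" "ball s0 r1 \<subseteq> ball 0 1" "g holomorphic_on ball s0 r1"
    "\<And>s. s \<in> ball s0 r1 \<Longrightarrow> 1 + w m s = (s - s0) ^ n * g s"
    "\<And>s. s \<in> ball s0 r1 \<Longrightarrow> g s \<noteq> 0"
  proof (rule holomorphic_factor_zero_nonconstant[of "\<lambda>s. 1 + w m s" "ball 0 1" s0])
    show "(\<lambda>s. 1 + w m s) holomorphic_on ball 0 1" by (intro holomorphic_intros hw)
    show "s0 \<in> ball 0 1" using s0(1) by (auto simp: cont_domain_def)
    \<comment> \<open>At s = 0 one has v = 1 and p = 0, so the value is 2 for m = 0 and 1 otherwise;
      as it vanishes at \<open>s0\<close>, the function is not constant.\<close>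
    moreover have "1 + w m 0 \<noteq> 0" by (cases m) (auto simp: w_def shift_def nome_def)
    moreover have "(0 :: complex) \<in> ball 0 1" by simp
    ultimately show "\<not> (\<lambda>s. 1 + w m s) constant_on ball 0 1"
      using wm unfolding constant_on_def by (metis add.right_inverse)
  qed (use wm in auto)
  have "open (cont_domain \<rho> K - (Z - {s0}))"
    using Z(1) by (intro open_Diff open_cont_domain finite_imp_closed) auto
  then obtain r2 where r2: "0 < r2" "ball s0 r2 \<subseteq> cont_domain \<rho> K - (Z - {s0})"
    using s0(1) openE[of _ s0] by (metis Diff_iff insertI1)
  define r where "r = min r1 r2"
  have r: "0 < r" "ball s0 r \<subseteq> cont_domain \<rho> K - (Z - {s0})" "ball s0 r \<subseteq> ball s0 r1"
    using r2 g(2) by (auto simp: r_def)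
  have good: "s \<noteq> 0 \<and> tpar s \<noteq> 1 / 3 \<and> (\<forall>k\<in>{..<K} - {m}. 1 + w k s \<noteq> 0)" if "s \<in> ball s0 r" for s
  proof (cases "s = s0")
    case True
    then show ?thesis using s0 other by auto
  next
    case False
    then have "s \<in> cont_domain \<rho> K - Z" using r(2) that by blast
    then show ?thesis using Z(2) by (auto simp: w_def)
  qed
  define a where "a s = (1 - 2 * (cont_prefactor s * ((1 - s\<^sup>2) / (1 + s ^ 4)
      - 2 * ((\<Sum>k. lambert_term (k + K) s) + (\<Sum>k\<in>{..<K} - {m}. lambert_term k s))))) / (1 - 3 * tpar s)" for s
  have rsub: "ball s0 r \<subseteq> cont_domain \<rho> K" "ball s0 r \<subseteq> param_domain" "ball s0 r \<subseteq> ball 0 1"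
    using r(2) cont_domain_subset_param_domain[of \<rho> K] \<rho> by (auto simp: param_domain_def)
  have g0: "0 \<notin> ball s0 r" using good[of 0] by blast
  have ha: "a holomorphic_on ball s0 r"
    unfolding a_def using good
    by (intro cont_part_holomorphic[OF \<rho> rsub(1) g0]) (auto simp: w_def simp del: mem_ball)
  \<comment> \<open>The factor 4 is (-2)(-2) from the two nested differences in
    \<open>counting_cont\<close>. At \<open>s0\<close> the first summand vanishes and the second
    does not, since w_m = -1 there.\<close>
  define h where "h s = a s * (s - s0) ^ n
      + 4 * (cont_prefactor s * ((-1) ^ m * w m s)) / (g s * (1 - 3 * tpar s))" for s
  show thesis
  proof (rule that[of n r h])
    show "h holomorphic_on ball s0 r" unfolding h_def
    proof (intro holomorphic_intros ha)
      show "cont_prefactor holomorphic_on ball s0 r"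
        by (rule holomorphic_on_cont_prefactor) (use g0 rsub in blast)
      show "w m holomorphic_on ball s0 r" "g holomorphic_on ball s0 r" "tpar holomorphic_on ball s0 r"
        using holomorphic_on_subset[OF hw rsub(3)] holomorphic_on_subset[OF g(4) r(3)]
          holomorphic_on_subset[OF holomorphic_on_tpar rsub(2)] by auto
      show "g s * (1 - 3 * tpar s) \<noteq> 0" if "s \<in> ball s0 r" for s
        using g(6)[of s] good[OF that] r(3) that by (auto simp: mult.commute)
    qed
    have s0p: "s0 \<in> param_domain" using rsub(2) r(1) by auto
    then have "cont_prefactor s0 \<noteq> 0"
      using tpar_nonzero[OF s0p s0(2)] tpar_denominator_nonzero[of s0] unit_disc_nonzero(3)[of s0]
      by (auto simp: cont_prefactor_def param_domain_def)
    then show "h s0 \<noteq> 0"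
      using g(1) g(6)[of s0] g(2) wm s0(3) by (auto simp: h_def mult.commute zero_power)
    show "counting_cont s = h s / (s - s0) ^ n" if s: "s \<in> ball s0 r - {s0}" for s
    proof -
      have sO: "s \<in> cont_domain \<rho> K" using s rsub(1) by auto
      have "(\<Sum>k<K. lambert_term k s) = lambert_term m s + (\<Sum>k\<in>{..<K} - {m}. lambert_term k s)"
        using mK by (intro sum.remove) auto
      moreover have "(1 - 2 * (M * (e - 2 * (T + (l + S))))) / d = (1 - 2 * (M * (e - 2 * (T + S)))) / d + 4 * (M * l) / d"
        for M e T l S d :: complex
        by (simp add: algebra_simps flip: add_divide_distrib)
      ultimately have "counting_cont s = a s + 4 * (cont_prefactor s * lambert_term m s) / (1 - 3 * tpar s)"
        unfolding counting_cont_eq[OF \<rho> sO] a_def by simp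
      moreover have "lambert_term m s = (-1) ^ m * w m s / ((s - s0) ^ n * g s)"
        using g(5)[of s] s r(3) by (auto simp: lambert_term_def w_def)
      moreover have "A + 4 * (M * (W / (x * G))) / d = (A * x + 4 * (M * W) / (G * d)) / x"
        if "x \<noteq> 0" for A M W x G d :: complex
        using that by (simp add: add_divide_distrib divide_divide_eq_left mult_ac)
      ultimately show ?thesis using s by (simp add: h_def)
    qed
  qed (use g r in auto)
qed

text \<open>The pole is chosen before \<rho> and \<open>K\<close>: for \<rho> < 1 a single
  \<open>cont_domain\<close> contains only finitely many of the poles, which accumulate where |p| =
  1. The claim about the top coefficient suffices, as it can be applied to the last nonzero
  coefficient of any relation.\<close>

lemma counting_gf_no_ode:
  assumes rel: "(\<Sum>k\<le>N. fps_of_poly (P k) * (fps_deriv ^^ k) (quarter_counting_gf three_steps)) = 0"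
  shows "P N = 0"
proof (rule ccontr)
  assume PN: "P N \<noteq> 0"
  define W where "W = quarter_counting_gf three_steps"
  \<comment> \<open>Finitely many points to be avoided by the pole: critical points of t, zeros of 1
    - 3t, and points over zeros of the leading coefficient.\<close>
  define Bad where "Bad = {s \<in> param_domain. deriv tpar s = 0} \<union> {s \<in> param_domain. tpar s = 1 / 3}
      \<union> (\<Union>r\<in>{r. poly (P N) r = 0}. {s \<in> param_domain. tpar s = r})"
  have finBad: "finite Bad" unfolding Bad_def
    by (intro finite_UnI finite_UN_I finite_tpar_critical finite_tpar_fibre poly_roots_finite[OF PN])
  define Pol where "Pol = {s. \<exists>y k. s = \<i> * of_real y \<and> 0 < y \<and> y < 1 \<and> norm (nome s) < 1 \<and>
      1 + shift s * nome s ^ k = 0}"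
  have "infinite Pol" unfolding Pol_def by (rule infinite_lambert_poles)
  then have "\<not> Pol \<subseteq> Bad" using finBad finite_subset by blast
  then obtain s0 where "s0 \<in> Pol" and s0B: "s0 \<notin> Bad" by blast
  then have "\<exists>y k. s0 = \<i> * of_real y \<and> 0 < y \<and> y < 1 \<and> norm (nome s0) < 1 \<and>
      1 + shift s0 * nome s0 ^ k = 0" by (simp only: Pol_def mem_Collect_eq)
  then obtain y0 m where s0: "s0 = \<i> * of_real y0" "0 < y0" "y0 < 1" "norm (nome s0) < 1"
    "1 + shift s0 * nome s0 ^ m = 0" by (elim exE conjE)
  have "norm s0 < 1" using s0 by (simp add: norm_mult)
  then have s0p: "s0 \<in> param_domain" using s0 by (simp add: param_domain_def)
  \<comment> \<open>The midpoint of |p(s0)| and 1 lies strictly between them; the maximum with 1/2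
    admits the real segment.\<close>
  define \<rho> where "\<rho> = max (1 / 2) ((norm (nome s0) + 1) / 2)"
  have \<rho>: "1 / 2 \<le> \<rho>" "0 < \<rho>" "\<rho> < 1" "norm (nome s0) < \<rho>" 
    using s0(4) by (auto simp: \<rho>_def less_max_iff_disj add_nonneg_pos)
  have pos: "0 < 1 + norm (shift s0)" by (simp add: add_pos_nonneg)
  then obtain K where "\<rho> ^ K < 1 / 2 / (1 + norm (shift s0))"
    using real_arch_pow_inv[of "1 / 2 / (1 + norm (shift s0))" \<rho>] \<rho> by auto
  then have "(1 + norm (shift s0)) * \<rho> ^ K < 1 / 2" using pos by (simp add: field_simps)
  moreover have "0 \<le> \<rho> ^ K" "0 \<le> norm (shift s0) * \<rho> ^ K" using \<rho> by auto
  ultimately have K: "\<rho> ^ K < 1 / 2" "norm (shift s0) * \<rho> ^ K < 1 / 2"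
    unfolding distrib_right by linarith+
  define D where "D = cont_domain \<rho> K"
  \<comment> \<open>The real segment towards 1 and the imaginary segment up to \<open>s0\<close>
    meet at 0, so both lie in the component of 0.\<close>
  define C where "C = connected_component_set D 0"
  have re: "of_real x \<in> D" if "0 \<le> x" "x < 1" for x
    unfolding D_def using real_segment_in_cont_domain[OF that \<rho>(1) K(1)] .
  have im: "\<i> * of_real y \<in> D" if "0 \<le> y" "y \<le> y0" for y
    unfolding D_def
    by (rule imaginary_segment_in_cont_domain[OF that])
       (use s0 \<rho> K in \<open>auto simp: power_less_one_iff\<close>)
  have reC: "of_real x \<in> C" if "0 \<le> x" "x < 1" for x
  proof -
    have "of_real ` {0..<1 :: real} \<subseteq> C" unfolding C_def
      by (rule connected_component_maximal)
         (use re in \<open>auto intro!: connected_continuous_image continuous_intros image_eqI[of _ _ 0]\<close>)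
    then show ?thesis using that by auto
  qed
  have imC: "s0 \<in> C"
  proof -
    have "(\<lambda>y. \<i> * of_real y) ` {0..y0} \<subseteq> C" unfolding C_def
      by (rule connected_component_maximal)
         (use im s0 in \<open>auto intro!: connected_continuous_image continuous_intros image_eqI[of _ _ 0]\<close>)
    then show ?thesis using s0 by auto
  qed
  have D: "open D" "D \<subseteq> param_domain" "C \<subseteq> D"
    using open_cont_domain cont_domain_subset_param_domain[of \<rho> K] \<rho>(3)
      connected_component_subset[of D 0]
    unfolding D_def C_def by simp_all
  have C: "open C" "connected C"
    using D(1) by (auto simp: C_def open_connected_component)
  \<comment> \<open>Deleting finitely many points keeps an open connected set connected. The pole
    \<open>s0\<close> is deleted as well and is approached through a punctured ball.\<close>
  define Z where "Z = {0} \<union> {s \<in> param_domain. tpar s = 1 / 3} \<union> {s \<in> param_domain. deriv tpar s = 0}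
      \<union> (\<Union>k<K. {s. norm s < 1 \<and> 1 + shift s * nome s ^ k = 0})"
  have Z: "finite Z" unfolding Z_def
    by (intro finite_UnI finite_UN_I finite_tpar_critical finite_tpar_fibre finite_lambert_poles) auto
  define \<Omega> where "\<Omega> = C - Z"
  have \<Omega>: "open \<Omega>" "connected \<Omega>" "\<Omega> \<subseteq> D" "\<Omega> \<subseteq> param_domain"
    using C Z D by (auto simp: \<Omega>_def intro!: open_Diff finite_imp_closed connected_open_delete_finite)
  have good: "s \<noteq> 0 \<and> tpar s \<noteq> 1 / 3 \<and> deriv tpar s \<noteq> 0 \<and> (\<forall>k<K. 1 + shift s * nome s ^ k \<noteq> 0)"
    if "s \<in> D" "s \<notin> Z" for s
    using that D(2) unfolding Z_def param_domain_def by blast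
  have holf: "counting_cont holomorphic_on \<Omega>"
  proof (rule holomorphic_transform)
    show "(\<lambda>s. (1 - 2 * (cont_prefactor s * ((1 - s\<^sup>2) / (1 + s ^ 4)
      - 2 * ((\<Sum>k. lambert_term (k + K) s) + (\<Sum>k\<in>{..<K}. lambert_term k s))))) / (1 - 3 * tpar s))
      holomorphic_on \<Omega>"
      using \<Omega>(3) good by (intro cont_part_holomorphic[OF \<rho>(2,3)]) (auto simp: D_def \<Omega>_def)
  qed (use \<Omega>(3) counting_cont_eq[OF \<rho>(2,3), of _ K] in \<open>auto simp: D_def\<close>)
  have holt: "tpar holomorphic_on \<Omega>" using holomorphic_on_tpar holomorphic_on_subset \<Omega>(4) by blast
  have rad: "ereal (1 / 3) \<le> fps_conv_radius W"
    using fps_conv_radius_counting_gf by (simp add: W_def one_ereal_def)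
  have holg: "eval_fps W holomorphic_on ball 0 (1 / 3)"
  proof (rule holomorphic_on_eval_fps)
    show "ball (0 :: complex) (1 / 3) \<subseteq> eball 0 (fps_conv_radius W)"
    proof
      fix x :: complex assume "x \<in> ball 0 (1 / 3)"
      then have "ereal (dist 0 x) < ereal (1 / 3)" by (simp only: mem_ball less_ereal.simps)
      from less_le_trans[OF this rad] show "x \<in> eball 0 (fps_conv_radius W)" by (simp only: in_eball_iff)
    qed
  qed
  have "infinite (complex_of_real ` {47 / 50<..<24 / 25})"
    by (subst finite_image_iff) (auto simp: inj_on_def infinite_Ioo)
  then have "\<not> complex_of_real ` {47 / 50<..<24 / 25} \<subseteq> Z" using Z finite_subset by blast
  then obtain x1 where x1: "47 / 50 < x1" "x1 < 24 / 25" "complex_of_real x1 \<notin> Z"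
    by (auto simp: image_subset_iff)
  have x1\<Omega>: "complex_of_real x1 \<in> \<Omega>" using reC[of x1] x1 by (auto simp: \<Omega>_def)
  have "open (\<Omega> \<inter> tpar -` ball 0 (1 / 3))"
    using holt \<Omega>(1) by (intro continuous_open_preimage holomorphic_on_imp_continuous_on) auto
  moreover have "complex_of_real x1 \<in> \<Omega> \<inter> tpar -` ball 0 (1 / 3)"
    using x1\<Omega> counting_gf_eq_counting_cont_real(1)[OF x1(1,2)] by simp
  ultimately obtain e where e: "0 < e" "ball (complex_of_real x1) e \<subseteq> \<Omega> \<inter> tpar -` ball 0 (1 / 3)"
    by (rule openE)
  define U where "U = ball (complex_of_real x1) e"
  have U: "open U" "connected U" "U \<noteq> {}" "U \<subseteq> \<Omega>" "tpar ` U \<subseteq> ball 0 (1 / 3)"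
    using e by (auto simp: U_def)
  \<comment> \<open>The equality is known only at real points; those of the interval accumulate at
    \<open>x1\<close>, and \<open>U\<close> is connected.\<close>
  have agree: "counting_cont s = eval_fps W (tpar s)" if "s \<in> U" for s
  proof -
    define R where "R = U \<inter> complex_of_real ` {47 / 50<..<24 / 25}"
    have "complex_of_real x1 islimpt R"
      unfolding islimpt_approachable
    proof (intro allI impI)
      fix d :: real assume d: "d > 0"
      have "0 < min (min d e) (24 / 25 - x1)" using d e(1) x1(2) by simp
      then obtain \<delta> where "0 < \<delta>" "\<delta> < min (min d e) (24 / 25 - x1)" using dense by blast
      then have \<delta>: "0 < \<delta>" "\<delta> < d" "\<delta> < e" "x1 + \<delta> < 24 / 25" by auto
      have ds: "dist (complex_of_real (x1 + \<delta>)) (complex_of_real x1) = \<delta>"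
        using \<delta> by (simp add: dist_norm)
      moreover have "complex_of_real (x1 + \<delta>) \<in> R"
        using \<delta> x1 ds by (auto simp: R_def U_def dist_commute simp del: of_real_add)
      ultimately show "\<exists>x'\<in>R. x' \<noteq> complex_of_real x1 \<and> dist x' (complex_of_real x1) < d"
        using \<delta> by (intro bexI[of _ "complex_of_real (x1 + \<delta>)"]) (auto simp del: of_real_add)
    qed
    moreover have "(\<lambda>s. counting_cont s - eval_fps W (tpar s)) holomorphic_on U"
    proof -
      have "(eval_fps W \<circ> tpar) holomorphic_on U"
        by (rule holomorphic_on_compose_gen[OF _ holg U(5)]) (use holt U(4) holomorphic_on_subset in blast)
      then show ?thesis using holomorphic_on_subset[OF holf U(4)]
        by (auto simp: o_def intro!: holomorphic_intros)
    qed
    moreover have "counting_cont z - eval_fps W (tpar z) = 0" if "z \<in> R" for z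
      using that counting_gf_eq_counting_cont_real(2) by (auto simp: R_def W_def)
    ultimately have "counting_cont s - eval_fps W (tpar s) = 0"
      using analytic_continuation[of "\<lambda>s. counting_cont s - eval_fps W (tpar s)" U R "complex_of_real x1" s]
        U \<open>s \<in> U\<close> e(1) by (auto simp: R_def U_def)
    then show ?thesis by simp
  qed
  have ode: "(\<Sum>k\<le>N. poly (P k) (tpar s) * ((\<lambda>h s. deriv h s / deriv tpar s) ^^ k) counting_cont s) = 0"
    if "s \<in> \<Omega>" for s
  proof (rule continue_ode_along_parametrisation[OF \<Omega>(1,2) holt holf _ _ holg U(1,3,4,5) agree])
    show "deriv tpar s \<noteq> 0" if "s \<in> \<Omega>" for s using good[of s] that \<Omega>(3) by (auto simp: \<Omega>_def)
    show "(\<Sum>k\<le>N. poly (P k) z * (deriv ^^ k) (eval_fps W) z) = 0" if "z \<in> ball 0 (1 / 3)" for z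
      using fps_ode_imp_ode[OF rel[folded W_def], of z "1 / 3"] that rad by simp
  qed (use that in auto)
  have nbad: "deriv tpar s0 \<noteq> 0" "tpar s0 \<noteq> 1 / 3" "poly (P N) (tpar s0) \<noteq> 0"
    using s0B s0p by (auto simp: Bad_def)
  obtain n r h where h: "0 < n" "0 < r" "h holomorphic_on ball s0 r" "h s0 \<noteq> 0"
    "\<And>s. s \<in> ball s0 r - {s0} \<Longrightarrow> counting_cont s = h s / (s - s0) ^ n"
    "ball s0 r \<subseteq> cont_domain \<rho> K - (Z - {s0})"
  proof (rule counting_cont_pole[OF \<rho>(2,3) _ _ nbad(2) s0(5) Z])
    show "s0 \<in> cont_domain \<rho> K" using imC D(3) by (auto simp: D_def)
    show "s0 \<noteq> 0" using s0 by simp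
    show "s \<noteq> 0 \<and> tpar s \<noteq> 1 / 3 \<and> (\<forall>k<K. 1 + shift s * nome s ^ k \<noteq> 0)"
      if "s \<in> cont_domain \<rho> K - Z" for s using good[of s] that by (simp add: D_def)
  qed (rule that)
  obtain r' where r': "0 < r'" "ball s0 r' \<subseteq> C" by (rule openE[OF C(1) imC])
  define q where "q = min r r'"
  have q: "0 < q" "ball s0 q \<subseteq> ball s0 r" "ball s0 q \<subseteq> C" "ball s0 q \<subseteq> D" "ball s0 q - {s0} \<subseteq> \<Omega>"
    using h(2,6) r' D(3) by (auto simp: q_def \<Omega>_def D_def)
  have "poly (P N) (tpar s0) = 0"
  proof (rule leading_coefficient_vanishes_at_pole[where t = tpar and P = P and f = counting_cont
        and h = h and m = n, OF q(1)])
    show "tpar holomorphic_on ball s0 q"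
      using holomorphic_on_tpar holomorphic_on_subset q(4) D(2) by blast
    show "h holomorphic_on ball s0 q" using h(3) holomorphic_on_subset q(2) by blast
    show "deriv tpar s \<noteq> 0" if "s \<in> ball s0 q" for s
    proof (cases "s = s0")
      case False
      then have "s \<in> D" "s \<notin> Z" using that q(4,5) unfolding \<Omega>_def by blast+
      then show ?thesis using good by blast
    qed (simp add: nbad(1))
  qed (use h q ode in auto)
  then show False using nbad by simp
qed

theorem theorem1:
  fixes S :: "(int \<times> int) set"
  assumes "S = {(-1, 1), (1, 1), (1, -1)}"
  shows "\<not> holonomic_xyt (quarter_gf S) \<and> \<not> holonomic_t (quarter_counting_gf S)"
proof -
  have no: False if P: "\<exists>k\<le>N. P k \<noteq> 0"
    "(\<Sum>k\<le>N. fps_of_poly (P k) * (fps_deriv ^^ k) (quarter_counting_gf S)) = 0" for N and P :: "nat \<Rightarrow> complex poly"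
  proof -
    \<comment> \<open>Truncating at the last nonzero coefficient makes it the leading one, which
      \<open>counting_gf_no_ode\<close> forces to be zero.\<close>
    define M where "M = Max {k. k \<le> N \<and> P k \<noteq> 0}"
    have fin: "finite {k. k \<le> N \<and> P k \<noteq> 0}" "{k. k \<le> N \<and> P k \<noteq> 0} \<noteq> {}" using P(1) by auto
    have M: "M \<le> N" "P M \<noteq> 0" using Max_in[OF fin] by (auto simp: M_def)
    have "P k = 0" if "k \<le> N" "k > M" for k
      using Max_ge[OF fin(1), of k, folded M_def] that by force
    then have "(\<Sum>k\<le>N. fps_of_poly (P k) * (fps_deriv ^^ k) (quarter_counting_gf S))
        = (\<Sum>k\<le>M. fps_of_poly (P k) * (fps_deriv ^^ k) (quarter_counting_gf S))"
      by (intro sum.mono_neutral_right) (use M in auto)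
    then show False using P(2) M(2) counting_gf_no_ode[of P M] unfolding assms by simp
  qed
  have "\<not> holonomic_t (quarter_counting_gf S)" using holonomic_t_imp_relation no by blast
  moreover have "\<not> holonomic_xyt (quarter_gf S)"
  proof
    assume hol: "holonomic_xyt (quarter_gf S)"
    have "finite S" using assms by simp
    then obtain q where q: "\<And>n. fps_nth (quarter_gf S) n = fps_of_poly_xy (q n)"
      "\<And>n. poly (poly (q n) 1) 1 = fps_nth (quarter_counting_gf S) n"
      using quarter_gf_nth_polynomial by blast
    have "Abs_fps (\<lambda>n. poly (poly (q n) 1) 1) = quarter_counting_gf S" by (simp add: q(2) fps_eq_iff)
    then show False using holonomic_xyt_imp_relation_eval[OF hol q(1)] no by auto
  qed
  ultimately show ?thesis by blast
qed

end
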